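(* Let $\lambda$ be a strong limit cardinal, let $\kappa=\mathrm{cf}(\lambda)$, and suppose $\mu^\omega<\kappa$ for every cardinal $\mu<\kappa$. Let $(\Omega,\Sigma,L_P)$ be a hyperfinite Loeb space (in some nonstandard universe) with $|\Omega|=\lambda$. Then $\Omega$ is not compact.
   Context: Work in ZFC. The standard universe $V$ is built over $\mathbb{N}$: $V_0=\mathbb{N}$, $V_{n+1}=V_n\cup\mathcal{P}(V_n)$, $V=\bigcup_n V_n$. A nonstandard universe ${}^*V$ is the truncation at ${}^*\!\in$-rank $\omega$ of an elementary extension of $(V,\in)$ with ${}^*\mathbb{N}\setminus\mathbb{N}\neq\emptyset$, always assumed $\omega_1$-saturated. A hyperfinite Loeb space: for $H\in{}^*\mathbb{N}\setminus\mathbb{N}$, $\Omega=\{1,\dots,H\}$, $P(A)={}^*|A|/H$ for internal $A\subseteq\Omega$; $(\Omega,\Sigma,L_P)$ is the Loeb measure space generated by the internal subsets and $\mathrm{st}\circ P$ (completed). $|\Omega|$ denotes external cardinality. A family $\mathcal{C}\subseteq\Sigma$ is compact if every subfamily with the finite intersection property has nonempty intersection, and inner-regular if $L_P(A)=\sup\{L_P(C):C\subseteq A,\ C\in\mathcal{C}\}$ for all $A\in\Sigma$. $\Omega$ is compact if it carries an inner-regular compact family. *)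

theory Defs
  imports "HOL-Analysis.Analysis"
begin

unbundle cardinal_syntax

section \<open>Cardinals\<close>

text \<open>Cardinals are represented by cardinal orders on a type. Every cardinal below \<open>r\<close> is
  realised by a cardinal order on the carrier type of \<open>r\<close>, so quantifying over relations on that
  type loses nothing.\<close>

definition strong_limit_cardinal :: "'a rel \<Rightarrow> bool" where
  "strong_limit_cardinal r \<longleftrightarrow>
     Card_order r \<and> cinfinite r \<and>
     (\<forall>\<mu> :: 'a rel. Card_order \<mu> \<and> \<mu> <o r \<longrightarrow> ctwo ^c \<mu> <o r)"

definition is_cofinality :: "'k rel \<Rightarrow> 'a rel \<Rightarrow> bool" where
  "is_cofinality k r \<longleftrightarrow>
     Card_order k \<and>
     (\<exists>K \<subseteq> Field r. cofinal K r \<and> |K| =o k) \<and>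
     (\<forall>K \<subseteq> Field r. cofinal K r \<longrightarrow> k \<le>o |K| )"

section \<open>Compact measure spaces\<close>

definition fip :: "'a set set \<Rightarrow> bool" where
  "fip \<D> \<longleftrightarrow> (\<forall>\<F> \<subseteq> \<D>. finite \<F> \<longrightarrow> \<Inter>\<F> \<noteq> {})"

definition compact_family :: "'a set set \<Rightarrow> bool" where
  "compact_family \<C> \<longleftrightarrow> (\<forall>\<D> \<subseteq> \<C>. fip \<D> \<longrightarrow> \<Inter>\<D> \<noteq> {})"

definition inner_regular_family :: "'a measure \<Rightarrow> 'a set set \<Rightarrow> bool" where
  "inner_regular_family M \<C> \<longleftrightarrow>
     (\<forall>A \<in> sets M. emeasure M A = (SUP C \<in> {C \<in> \<C>. C \<subseteq> A}. emeasure M C))"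

definition compact_measure_space :: "'a measure \<Rightarrow> bool" where
  "compact_measure_space M \<longleftrightarrow>
     (\<exists>\<C> \<subseteq> sets M. compact_family \<C> \<and> inner_regular_family M \<C>)"

section \<open>First-order logic of a binary relation\<close>

datatype fm = FMem nat nat | FEq nat nat | FNeg fm | FConj fm fm | FEx nat fm

primrec sat :: "('a \<Rightarrow> 'a \<Rightarrow> bool) \<Rightarrow> fm \<Rightarrow> (nat \<Rightarrow> 'a) \<Rightarrow> bool" where
  "sat E (FMem i k) e \<longleftrightarrow> E (e i) (e k)"
| "sat E (FEq i k) e \<longleftrightarrow> e i = e k"
| "sat E (FNeg p) e \<longleftrightarrow> \<not> sat E p e"
| "sat E (FConj p q) e \<longleftrightarrow> sat E p e \<and> sat E q e"
| "sat E (FEx i p) e \<longleftrightarrow> (\<exists>x. sat E p (e(i := x)))"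

definition elementary_embedding ::
  "('a \<Rightarrow> 'a \<Rightarrow> bool) \<Rightarrow> ('b \<Rightarrow> 'b \<Rightarrow> bool) \<Rightarrow> ('a \<Rightarrow> 'b) \<Rightarrow> bool" where
  "elementary_embedding E E' j \<longleftrightarrow> (\<forall>p e. sat E p e \<longleftrightarrow> sat E' p (j \<circ> e))"

section \<open>Superstructures\<close>

text \<open>The elements of rank at most \<open>n\<close> over the base set \<open>B\<close>. Base elements will always be
  memberless.\<close>

primrec rank_level :: "'a set \<Rightarrow> ('a \<Rightarrow> 'a \<Rightarrow> bool) \<Rightarrow> nat \<Rightarrow> 'a set" where
  "rank_level B E 0 = B"
| "rank_level B E (Suc n) = rank_level B E n \<union> {x. {y. E y x} \<subseteq> rank_level B E n}"

text \<open>Kuratowski pairs, and membership of a pair in a relation, read in the structure \<open>E\<close>.\<close>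

definition is_pair :: "('a \<Rightarrow> 'a \<Rightarrow> bool) \<Rightarrow> 'a \<Rightarrow> 'a \<Rightarrow> 'a \<Rightarrow> bool" where
  "is_pair E p x y \<longleftrightarrow>
     (\<exists>s t. (\<forall>z. E z s \<longleftrightarrow> z = x) \<and> (\<forall>z. E z t \<longleftrightarrow> z = x \<or> z = y) \<and>
            (\<forall>z. E z p \<longleftrightarrow> z = s \<or> z = t))"

definition related :: "('a \<Rightarrow> 'a \<Rightarrow> bool) \<Rightarrow> 'a \<Rightarrow> 'a \<Rightarrow> 'a \<Rightarrow> bool" where
  "related E r x y \<longleftrightarrow> (\<exists>p. is_pair E p x y \<and> E p r)"

text \<open>The axioms say that \<open>('v, mem)\<close> is isomorphic to the superstructure over the natural numbers,
  whose elements are urelements. The superstructure has cardinality \<open>\<beth>\<^sub>\<omega>\<close>, so HOL cannot define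
  such a type outright.\<close>

locale superstructure =
  fixes atom :: "nat \<Rightarrow> 'v" and mem :: "'v \<Rightarrow> 'v \<Rightarrow> bool"
  assumes inj_atom: "inj atom"
    and atom_memberless: "\<not> mem x (atom n)"
    and extensionality:
      "x \<notin> range atom \<Longrightarrow> y \<notin> range atom \<Longrightarrow> (\<And>z. mem z x \<longleftrightarrow> mem z y) \<Longrightarrow> x = y"
    and all_subsets:
      "A \<subseteq> rank_level (range atom) mem n \<Longrightarrow> \<exists>x. x \<notin> range atom \<and> {y. mem y x} = A"
    and finite_rank: "\<exists>n. x \<in> rank_level (range atom) mem n"
begin

definition mk_set :: "'v set \<Rightarrow> 'v" where
  "mk_set A = (THE x. x \<notin> range atom \<and> {y. mem y x} = A)"

definition nat_set :: 'v where
  "nat_set = mk_set (range atom)"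

definition nat_rel :: "(nat \<Rightarrow> nat \<Rightarrow> bool) \<Rightarrow> 'v" where
  "nat_rel R = mk_set {p. \<exists>m n. R m n \<and> is_pair mem p (atom m) (atom n)}"

text \<open>The graph of the cardinality function on the finite sets of natural numbers.\<close>

definition card_graph :: 'v where
  "card_graph =
     mk_set {p. \<exists>A. finite A \<and> is_pair mem p (mk_set (atom ` A)) (atom (card A))}"

end

section \<open>Nonstandard universes\<close>

locale elementary_extension = superstructure atom mem
  for atom :: "nat \<Rightarrow> 'v" and mem :: "'v \<Rightarrow> 'v \<Rightarrow> bool" +
  fixes smem :: "'w \<Rightarrow> 'w \<Rightarrow> bool" and star :: "'v \<Rightarrow> 'w"
  assumes elementary: "elementary_embedding mem smem star"
begin

definition hypernats :: "'w set" where
  "hypernats = {x. smem x (star nat_set)}"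

definition standard_nats :: "'w set" where
  "standard_nats = range (\<lambda>n. star (atom n))"

text \<open>The truncation to finite rank over the hypernaturals; by elementarity, level \<open>n\<close> consists of
  the members of the star-image of the \<open>n\<close>-th level of the standard universe.\<close>

definition star_universe :: "'w set" where
  "star_universe = (\<Union>n. rank_level hypernats smem n)"

definition internal_sets :: "'w set set" where
  "internal_sets = (\<lambda>s. {x. smem x s}) ` star_universe"

definition star_rel :: "(nat \<Rightarrow> nat \<Rightarrow> bool) \<Rightarrow> 'w \<Rightarrow> 'w \<Rightarrow> bool" where
  "star_rel R = related smem (star (nat_rel R))"

definition initial_segment :: "'w \<Rightarrow> 'w set" where
  "initial_segment H =
     {x \<in> hypernats. star_rel (\<le>) (star (atom 1)) x \<and> star_rel (\<le>) x H}"

definition internal_card :: "'w set \<Rightarrow> 'w" where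
  "internal_card A =
     (THE m. \<exists>s. {x. smem x s} = A \<and> related smem (star card_graph) s m)"

text \<open>The standard part of the quotient \<open>a / b\<close> of hypernaturals: the real \<open>r\<close> with
  \<open>\<bar>a / b - r\<bar> < \<epsilon>\<close> for all standard \<open>\<epsilon> > 0\<close>, where this inequality is the star-extension
  of the corresponding relation between natural numbers.\<close>

definition st_quotient :: "'w \<Rightarrow> 'w \<Rightarrow> real" where
  "st_quotient a b =
     (THE r. \<forall>\<epsilon>>0. star_rel (\<lambda>m n. \<bar>real m / real n - r\<bar> < \<epsilon>) a b)"

definition loeb_measure :: "'w \<Rightarrow> 'w measure" where
  "loeb_measure H =
     completion
       (extend_measure (initial_segment H) {A \<in> internal_sets. A \<subseteq> initial_segment H} (\<lambda>A. A)
         (\<lambda>A. ennreal (st_quotient (internal_card A) H)))"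

end

locale nonstandard_universe = elementary_extension +
  assumes nonstandard: "hypernats - standard_nats \<noteq> {}"
    and omega1_saturated:
      "\<C> \<subseteq> internal_sets \<Longrightarrow> countable \<C> \<Longrightarrow> fip \<C> \<Longrightarrow> \<Inter>\<C> \<noteq> {}"

end

theory Submission
  imports Defs "HOL-Library.Countable_Set_Type"
begin

text \<open>Let \<open>K\<close> consist of the hypernaturals \<open>k\<close> with \<open>2\<^sup>k \<le> H\<close>. The binary digits with index in \<open>K\<close> separate
  the points of \<open>\<Omega>\<close>, so \<open>|K| \<ge> \<lambda>\<close> because \<open>\<lambda>\<close> is a strong limit; and any two of these digits differ on
  an internal set of measure at least \<open>1/4\<close>. A set \<open>Y\<close> of fewer than \<open>\<lambda>\<close> points has fewer than \<open>\<lambda>\<close>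
  subsets, so two digits agree on \<open>Y\<close>, and \<open>Y\<close> misses an internal set of positive measure.
  Now write \<open>\<Omega>\<close> as an increasing union of sets \<open>Y\<^sub>i\<close> of size less than \<open>\<lambda>\<close>, for \<open>i < \<kappa>\<close>. Given an
  inner-regular family, choose members \<open>C\<^sub>i\<close> of positive measure with \<open>C\<^sub>i \<inter> Y\<^sub>i = {}\<close>. Since \<open>\<mu>\<^sup>\<omega> < \<kappa>\<close> for
  \<open>\<mu> < \<kappa>\<close>, the cardinal \<open>\<kappa>\<close> is a precaliber of finite measures: unboundedly many of the \<open>C\<^sub>i\<close> have the
  finite intersection property. But their intersection misses every \<open>Y\<^sub>i\<close>, so it is empty.\<close>

section \<open>Precalibers of finite measures\<close>

text \<open>If every fibre of \<open>N\<close> were bounded, one could build an increasing chain of length \<open>\<omega>\<^sub>1\<close>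
  whose later terms bound all the fibres coded below the earlier ones. At the supremum \<open>\<delta>\<close> of the
  chain, the countable code of \<open>N \<delta>\<close> already lies below some term of the chain, so the fibre
  of \<open>\<delta>\<close> is bounded below \<open>\<delta>\<close>.\<close>

lemma pressing_down:
  fixes r :: "'k rel" and N :: "'k \<Rightarrow> 'b" and T :: "'k \<Rightarrow> 'b set"
  assumes wo: "Well_order r"
    and uncountable: "cardSuc natLeq <o r"
    and bounded: "\<And>K. K \<subseteq> Field r \<Longrightarrow> |K| <o r \<Longrightarrow> \<exists>z\<in>Field r. K \<subseteq> underS r z"
    and small: "\<And>z. z \<in> Field r \<Longrightarrow> |T z| <o r"
    and code: "\<And>i. i \<in> Field r \<Longrightarrow>
      \<exists>A. countable A \<and> A \<subseteq> underS r i \<and> (\<forall>z\<in>Field r. A \<subseteq> underS r z \<longrightarrow> N i \<in> T z)"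
  shows "\<exists>b. \<forall>z\<in>Field r. \<exists>i\<in>Field r. N i = b \<and> z \<in> under r i"
proof (rule ccontr)
  have wr: "wo_rel r"
    using wo by (simp add: wo_rel_def)
  note TRANS = wo_rel.TRANS[OF wr] and ANTISYM = wo_rel.ANTISYM[OF wr]
    and TOTALS = wo_rel.TOTALS[OF wr] and REFL = wo_rel.REFL[OF wr]
  let ?w = "cardSuc natLeq"
  have w_card: "Card_order ?w"
    by (simp add: cardSuc_Card_order natLeq_Card_order)
  then have w_wo: "Well_order ?w"
    by (rule card_order_on_well_order_on)
  assume "\<not> ?thesis"
  then have "\<forall>b. \<exists>z\<in>Field r. \<forall>i\<in>Field r. N i = b \<longrightarrow> z \<notin> under r i"
    by blast
  \<comment> \<open>\<open>g b\<close> witnesses that the fibre over \<open>b\<close> is bounded: no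
    index with value \<open>b\<close> reaches it.\<close>
  then obtain g where g: "\<And>b. g b \<in> Field r"
    "\<And>b i. i \<in> Field r \<Longrightarrow> N i = b \<Longrightarrow> g b \<notin> under r i"
    by metis
  have "\<exists>y\<in>Field r. g ` T z \<subseteq> underS r y" if "z \<in> Field r" for z
  proof (rule bounded)
    show "|g ` T z| <o r"
      using card_of_image small[OF that] by (rule ordLeq_ordLess_trans)
  qed (use g in blast)
  \<comment> \<open>\<open>T z\<close> is small, so a single index \<open>G z\<close> can lie
    strictly above the fibre bounds of all values in \<open>T z\<close>.\<close>
  then obtain G where G: "\<And>z. z \<in> Field r \<Longrightarrow> G z \<in> Field r"
    "\<And>z. z \<in> Field r \<Longrightarrow> g ` T z \<subseteq> underS r (G z)"
    by metis
  \<comment> \<open>Recursion clause for the chain: \<open>d x\<close> lies strictly above each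
    earlier \<open>d y\<close> and \<open>G (d y)\<close>. For \<open>x\<close> outside the field of
    \<open>?w\<close> it only asks for a value in \<open>Field r\<close>.\<close>
  define P where "P d x z \<longleftrightarrow> z \<in> Field r \<and>
      (\<forall>y. (y, x) \<in> ?w - Id \<longrightarrow> d y \<in> underS r z \<and> G (d y) \<in> underS r z)" for d x z
  have "\<exists>d. \<forall>x. P d x (d x)"
  proof (rule dependent_wf_choice)
    show "wf (?w - Id)"
      using w_wo by (simp add: well_order_on_def)
  next
    fix x d assume IH: "\<And>y. (y, x) \<in> ?w - Id \<Longrightarrow> P d y (d y)"
    have eq: "{y. (y, x) \<in> ?w - Id} = underS ?w x"
      by (auto simp: underS_def)
    let ?K = "d ` underS ?w x \<union> G ` d ` underS ?w x"
    have "countable (underS ?w x)"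
    proof (cases "x \<in> Field ?w")
      case False
      then have "underS ?w x = {}"
        by (auto simp: underS_def Field_def)
      then show ?thesis
        by simp
    next
      case True
      then have "|underS ?w x| \<le>o natLeq"
        using card_of_underS[OF w_card True] cardSuc_ordLeq_ordLess[OF natLeq_Card_order card_of_Card_order]
        by blast
      then show ?thesis
        by (simp add: countable_card_le_natLeq)
    qed
    then have "countable ?K"
      by blast
    then have "|?K| \<le>o natLeq"
      by (simp add: countable_card_le_natLeq)
    then have "|?K| <o r"
      using ordLess_transitive[OF cardSuc_greater[OF natLeq_Card_order] uncountable]
      by (rule ordLeq_ordLess_trans)
    moreover have "?K \<subseteq> Field r"
      using IH G(1) eq unfolding P_def by blast
    ultimately obtain z where "z \<in> Field r" "?K \<subseteq> underS r z"
      using bounded[of ?K] by blast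
    then show "\<exists>z. P d x z"
      unfolding P_def using eq by blast
  qed (simp add: P_def)
  then obtain d where d: "\<And>x. P d x (d x)"
    by blast
  have dF: "d x \<in> Field r" for x
    using d by (simp add: P_def)
  have dS: "d y \<in> underS r (d x)" "G (d y) \<in> underS r (d x)" if "(y, x) \<in> ?w" "y \<noteq> x" for x y
    using d[of x] that by (auto simp: P_def)
  have w_inf: "infinite (Field ?w)"
    using cardSuc_finite[OF natLeq_Card_order] by (simp add: Field_natLeq)
  have next_w: "\<exists>y. (x, y) \<in> ?w \<and> x \<noteq> y" if "x \<in> Field ?w" for x
    using infinite_Card_order_limit[OF w_card w_inf that] by blast
  \<comment> \<open>These are the strict upper bounds of the chain; the least of them,
    \<open>\<delta>\<close>, serves as its supremum.\<close>
  define S where "S = {z \<in> Field r. d ` Field ?w \<subseteq> underS r z}"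
  have "|d ` Field ?w| <o r"
    using ordLeq_ordIso_trans[OF card_of_image card_of_Field_ordIso[OF w_card]] uncountable
    by (rule ordLeq_ordLess_trans)
  then have "S \<noteq> {}"
    using bounded[of "d ` Field ?w"] dF unfolding S_def by blast
  have "S \<subseteq> Field r"
    by (auto simp: S_def)
  define \<delta> where "\<delta> = wo_rel.minim r S"
  have \<delta>: "\<delta> \<in> S" "\<delta> \<in> Field r"
    using wo_rel.minim_in[OF wr \<open>S \<subseteq> Field r\<close> \<open>S \<noteq> {}\<close>] wo_rel.minim_inField[OF wr \<open>S \<subseteq> Field r\<close> \<open>S \<noteq> {}\<close>]
    unfolding \<delta>_def by auto
  obtain A where A: "countable A" "A \<subseteq> underS r \<delta>"
    "\<And>z. z \<in> Field r \<Longrightarrow> A \<subseteq> underS r z \<Longrightarrow> N \<delta> \<in> T z"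
    using code[OF \<delta>(2)] by blast
  \<comment> \<open>A successor cardinal is regular, so one member of the increasing union absorbs
    the countable set \<open>A\<close>.\<close>
  have "\<exists>x \<in> Field ?w. A \<subseteq> underS r (d x)"
  proof (rule cardSuc_UNION)
    show "Card_order natLeq"
      by (rule natLeq_Card_order)
    show "infinite (Field natLeq)"
      by (simp add: Field_natLeq)
    show "relChain ?w (\<lambda>x. underS r (d x))"
      unfolding relChain_def
    proof (intro allI impI)
      fix x y assume "(x, y) \<in> ?w"
      then show "underS r (d x) \<subseteq> underS r (d y)"
        using dS(1)[of x y] TRANS ANTISYM
        by (cases "x = y") (auto simp: underS_def dest: transD antisymD)
    qed
    show "|A| \<le>o natLeq"
      using A(1) by (simp add: countable_card_le_natLeq)
    show "A \<subseteq> (\<Union>x\<in>Field ?w. underS r (d x))"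
    proof
      fix a assume "a \<in> A"
      then have a: "a \<in> underS r \<delta>"
        using A(2) by blast
      then have aF: "a \<in> Field r"
        by (auto simp: underS_def Field_def)
      \<comment> \<open>Being below the least strict bound, \<open>a\<close> is not a strict bound.
        Hence some \<open>d x\<close> is at or above \<open>a\<close>, and a later term is strictly
        above it.\<close>
      have "a \<notin> S"
      proof
        assume "a \<in> S"
        then have "(\<delta>, a) \<in> r"
          unfolding \<delta>_def using \<open>S \<subseteq> Field r\<close> by (simp add: wo_rel.minim_least[OF wr])
        then show False
          using a ANTISYM by (auto simp: underS_def dest: antisymD)
      qed
      then obtain x where x: "x \<in> Field ?w" "d x \<notin> underS r a"
        using aF by (auto simp: S_def)
      then have "(a, d x) \<in> r"
        using TOTALS aF dF[of x] REFL by (auto simp: underS_def dest: refl_onD)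
      obtain y where y: "(x, y) \<in> ?w" "x \<noteq> y"
        using next_w x by blast
      have "a \<in> underS r (d y)"
        using \<open>(a, d x) \<in> r\<close> dS(1)[OF y] TRANS ANTISYM
        by (auto simp: underS_def dest: transD antisymD)
      moreover have "y \<in> Field ?w"
        using y by (auto simp: Field_def)
      ultimately show "a \<in> (\<Union>x\<in>Field ?w. underS r (d x))"
        by blast
    qed
  qed
  then obtain x where x: "x \<in> Field ?w" "A \<subseteq> underS r (d x)"
    by blast
  obtain y where y: "(x, y) \<in> ?w" "x \<noteq> y"
    using next_w x by blast
  then have "y \<in> Field ?w"
    by (auto simp: Field_def)
  \<comment> \<open>Now \<open>g (N \<delta>)\<close> is below \<open>G (d x)\<close>, which is
    below \<open>d y\<close>, which is below \<open>\<delta>\<close>. This contradicts the choice of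
    \<open>g\<close> at the index \<open>\<delta>\<close>.\<close>
  have "N \<delta> \<in> T (d x)"
    using A(3) x dF by blast
  then have "(g (N \<delta>), G (d x)) \<in> r"
    using G(2)[OF dF] by (auto simp: underS_def)
  moreover have "(G (d x), d y) \<in> r"
    using dS[OF y] by (auto simp: underS_def)
  moreover have "(d y, \<delta>) \<in> r"
    using \<delta> \<open>y \<in> Field ?w\<close> by (auto simp: S_def underS_def)
  ultimately have "(g (N \<delta>), \<delta>) \<in> r"
    using TRANS by (meson transD)
  then show False
    using g(2)[OF \<delta>(2) refl] by (simp add: under_def)
qed

text \<open>Combine countable subfamilies whose unions have measures approaching the supremum over
  all countable subfamilies. The result attains the supremum, so adjoining one more member cannot
  add measure.\<close>

lemma (in finite_measure) essential_union:
  assumes "\<X> \<subseteq> sets M"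
  shows "\<exists>\<Y>\<subseteq>\<X>. countable \<Y> \<and> (\<forall>X\<in>\<X>. measure M (X - \<Union>\<Y>) = 0)"
proof -
  let ?\<C> = "{\<Y>. \<Y> \<subseteq> \<X> \<and> countable \<Y>}"
  let ?s = "SUP \<Y>\<in>?\<C>. measure M (\<Union>\<Y>)"
  have bdd: "bdd_above ((\<lambda>\<Y>. measure M (\<Union>\<Y>)) ` ?\<C>)"
    by (rule bdd_aboveI[of _ "measure M (space M)"]) (auto simp: bounded_measure)
  have ne: "?\<C> \<noteq> {}"
    by blast
  have "\<forall>n. \<exists>\<Y>. \<Y> \<in> ?\<C> \<and> ?s - 1 / real (Suc n) < measure M (\<Union>\<Y>)"
  proof
    fix n
    have "?s - 1 / real (Suc n) < ?s"
      by simp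
    then show "\<exists>\<Y>. \<Y> \<in> ?\<C> \<and> ?s - 1 / real (Suc n) < measure M (\<Union>\<Y>)"
      unfolding less_cSUP_iff[OF ne bdd] by blast
  qed
  then obtain Y where "\<forall>n. Y n \<in> ?\<C> \<and> ?s - 1 / real (Suc n) < measure M (\<Union>(Y n))"
    by (rule choice[THEN exE])
  then have Y: "\<And>n. Y n \<in> ?\<C>" "\<And>n. ?s - 1 / real (Suc n) < measure M (\<Union>(Y n))"
    by simp_all
  define \<Y> where "\<Y> = (\<Union>n. Y n)"
  have \<Y>: "\<Y> \<in> ?\<C>"
    using Y(1) unfolding \<Y>_def by auto
  have meas: "\<Union>\<Z> \<in> sets M" if "\<Z> \<in> ?\<C>" for \<Z>
    using that assms by (intro sets.countable_Union) auto
  have "?s - 1 / real (Suc n) \<le> measure M (\<Union>\<Y>)" for n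
  proof -
    have "measure M (\<Union>(Y n)) \<le> measure M (\<Union>\<Y>)"
      using meas[OF \<Y>] by (intro finite_measure_mono) (auto simp: \<Y>_def)
    then show ?thesis
      using Y(2)[of n] by linarith
  qed
  then have le: "?s \<le> measure M (\<Union>\<Y>)"
    using LIMSEQ_le_const2[of "\<lambda>n. ?s - 1 / real (Suc n)" ?s "measure M (\<Union>\<Y>)"]
      tendsto_diff[OF tendsto_const LIMSEQ_inverse_real_of_nat, of ?s] by (simp add: inverse_eq_divide)
  have "measure M (X - \<Union>\<Y>) = 0" if "X \<in> \<X>" for X
  proof -
    have "insert X \<Y> \<in> ?\<C>"
      using \<Y> that by auto
    then have "measure M (\<Union>(insert X \<Y>)) \<le> ?s"
      using bdd by (rule cSUP_upper)
    moreover have "\<Union>(insert X \<Y>) = \<Union>\<Y> \<union> (X - \<Union>\<Y>)"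
      by auto
    then have "measure M (\<Union>(insert X \<Y>)) = measure M (\<Union>\<Y>) + measure M (X - \<Union>\<Y>)"
      using meas[OF \<Y>] that assms by (simp only:) (intro finite_measure_Union; auto)
    ultimately show ?thesis
      using le measure_nonneg[of M "X - \<Union>\<Y>"] by linarith
  qed
  then show ?thesis
    using \<Y> by blast
qed

lemma well_order_finite_max:
  assumes "Well_order r" and "finite F" and "F \<noteq> {}" and "F \<subseteq> Field r"
  shows "\<exists>m\<in>F. F - {m} \<subseteq> underS r m"
proof -
  have wr: "wo_rel r"
    using assms(1) by (simp add: wo_rel_def)
  have "\<exists>m\<in>F. \<forall>x\<in>F. (x, m) \<in> r"
    using assms(2-)
  proof (induction F rule: finite_ne_induct)
    case (singleton x)
    then show ?case
      using wo_rel.REFL[OF wr] by (auto dest: refl_onD)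
  next
    case (insert x F)
    then obtain m where m: "m \<in> F" "\<forall>y\<in>F. (y, m) \<in> r"
      by auto
    have "(x, m) \<in> r \<or> (m, x) \<in> r" "(x, x) \<in> r"
      using wo_rel.TOTALS[OF wr] insert.prems m(1) by blast+
    then show ?case
      using m wo_rel.TRANS[OF wr] by (metis insert_iff transD)
  qed
  then show ?thesis
    by (auto simp: underS_def)
qed

lemma finite_ordLess_Card_order:
  assumes "finite A" and "Card_order r" and "infinite (Field r)"
  shows "|A| <o r"
  using finite_ordLess_infinite[OF card_of_Well_order card_order_on_well_order_on[OF assms(2)]]
    assms(1,3) by (simp add: Field_card_of)

text \<open>\<open>N i\<close> is the essential union of the finite intersections of earlier sets \<open>C j\<close> that meet
  \<open>C i\<close> in a null set; it is given by a countable sequence of indices below \<open>i\<close>, so pressing down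
  makes it constant, say \<open>b\<close>, on an unbounded set \<open>J\<close>. If a finite intersection over \<open>J\<close> has positive
  measure outside \<open>b = N m\<close>, then so does its intersection with the next \<open>C m\<close>.\<close>

lemma (in finite_measure) caliber:
  fixes r :: "'k rel" and C :: "'k \<Rightarrow> 'a set"
  assumes card: "Card_order r" and inf: "infinite (Field r)"
    and bounded: "\<And>K. K \<subseteq> Field r \<Longrightarrow> |K| <o r \<Longrightarrow> \<exists>z\<in>Field r. K \<subseteq> underS r z"
    and omega_power: "\<And>A :: 'k set. |A| <o r \<Longrightarrow> |Func (UNIV :: nat set) A| <o r"
    and C: "\<And>i. i \<in> Field r \<Longrightarrow> C i \<in> sets M" "\<And>i. i \<in> Field r \<Longrightarrow> 0 < measure M (C i)"
  shows "\<exists>J\<subseteq>Field r. (\<forall>z\<in>Field r. \<exists>i\<in>J. z \<in> under r i) \<and>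
    (\<forall>F\<subseteq>J. finite F \<longrightarrow> F \<noteq> {} \<longrightarrow> 0 < measure M (\<Inter>i\<in>F. C i))"
proof -
  have wo: "Well_order r"
    using card by (rule card_order_on_well_order_on)
  \<comment> \<open>A two-element set already has continuum many \<omega>-sequences, so the
    continuum, and with it the first uncountable cardinal, is below \<open>r\<close>.\<close>
  have uncountable: "cardSuc natLeq <o r"
  proof -
    obtain a where "a \<in> Field r"
      using inf by fastforce
    obtain b where "b \<in> Field r" "b \<noteq> a"
      using inf by (metis finite.emptyI finite_insert finite_subset insert_iff subsetI)
    have "inj_on (\<lambda>S n. if n \<in> S then a else b) (UNIV :: nat set set)"
      using \<open>b \<noteq> a\<close> by (intro inj_onI set_eqI) (metis (mono_tags))
    then have "|UNIV :: nat set set| \<le>o |Func (UNIV :: nat set) {a, b}|"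
      by (intro card_of_ordLeqI[where f="\<lambda>S n. if n \<in> S then a else b"]) (auto simp: Func_def)
    then have lt: "|UNIV :: nat set set| <o r"
      using omega_power[of "{a, b}"] finite_ordLess_Card_order[OF _ card inf, of "{a, b}"]
      by (blast intro: ordLeq_ordLess_trans)
    have "natLeq <o |UNIV :: nat set set|"
      using Card_order_Pow[OF natLeq_Card_order] by (simp add: Field_natLeq)
    then have "cardSuc natLeq \<le>o |UNIV :: nat set set|"
      using cardSuc_ordLess_ordLeq[OF natLeq_Card_order card_of_Card_order] by blast
    then show ?thesis
      using lt by (rule ordLeq_ordLess_trans)
  qed
  define X where "X i = {\<Inter>(C ` F) | F. finite F \<and> F \<noteq> {} \<and> F \<subseteq> underS r i \<and>
    measure M (\<Inter>(C ` F) \<inter> C i) = 0}" for i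
  have CF: "\<Inter>(C ` F) \<in> sets M" if "finite F" "F \<noteq> {}" "F \<subseteq> Field r" for F
    using that C(1) by (intro sets.finite_INT) auto
  have underS_Field: "underS r i \<subseteq> Field r" for i
    by (auto simp: underS_def Field_def)
  have X_sets: "X i \<subseteq> sets M" for i
    unfolding X_def using CF underS_Field by blast
  have "\<exists>\<Y>. \<Y> \<subseteq> X i \<and> countable \<Y> \<and> (\<forall>Z\<in>X i. measure M (Z - \<Union>\<Y>) = 0)" for i
    using essential_union[OF X_sets] by blast
  then obtain \<Y> where \<Y>: "\<And>i. \<Y> i \<subseteq> X i" "\<And>i. countable (\<Y> i)"
    "\<And>i Z. Z \<in> X i \<Longrightarrow> measure M (Z - \<Union>(\<Y> i)) = 0"
    by metis
  define N where "N i = \<Union>(\<Y> i)" for i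
  have N_sets: "N i \<in> sets M" for i
    unfolding N_def using \<Y>(1,2) X_sets by (intro sets.countable_Union) blast+
  have N_null: "N i \<inter> C i \<in> null_sets M" if "i \<in> Field r" for i
  proof -
    have "(\<Union>Y\<in>\<Y> i. Y \<inter> C i) \<in> null_sets M"
    proof (rule null_sets_UN')
      fix Y assume "Y \<in> \<Y> i"
      then have "Y \<in> X i"
        using \<Y>(1) by blast
      then have "measure M (Y \<inter> C i) = 0" "Y \<inter> C i \<in> sets M"
        using X_sets C(1)[OF that] by (auto simp: X_def)
      then show "Y \<inter> C i \<in> null_sets M"
        by (simp add: null_setsI emeasure_eq_measure)
    qed (rule \<Y>(2))
    moreover have "N i \<inter> C i = (\<Union>Y\<in>\<Y> i. Y \<inter> C i)"
      by (auto simp: N_def)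
    ultimately show ?thesis
      by simp
  qed
  \<comment> \<open>All sets coded by one \<omega>-sequence of indices below \<open>z\<close>;
    \<open>prod_encode\<close> packs countably many enumerated finite index sets into one sequence.
    The empty set is added by hand because there may be no index below \<open>z\<close>.\<close>
  define T where "T z = insert {} ((\<lambda>s. \<Union>n. \<Inter>m. C (s (prod_encode (n, m)))) `
    Func (UNIV :: nat set) (underS r z))" for z
  have "\<exists>b. \<forall>z\<in>Field r. \<exists>i\<in>Field r. N i = b \<and> z \<in> under r i"
  proof (rule pressing_down[OF wo uncountable bounded])
    fix z assume "z \<in> Field r"
    then have "|Func (UNIV :: nat set) (underS r z)| <o r"
      by (intro omega_power card_of_underS card)
    then have "|(\<lambda>s. \<Union>n. \<Inter>m. C (s (prod_encode (n, m)))) ` Func (UNIV :: nat set) (underS r z)| <o r"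
      by (rule ordLeq_ordLess_trans[OF card_of_image])
    then have "|{{}} \<union> (\<lambda>s. \<Union>n. \<Inter>m. C (s (prod_encode (n, m)))) ` Func (UNIV :: nat set) (underS r z)| <o r"
      by (rule card_of_Un_ordLess_infinite_Field[OF inf card, rotated])
        (simp add: finite_ordLess_Card_order card inf)
    then show "|T z| <o r"
      by (simp add: T_def)
  next
    fix i assume "i \<in> Field r"
    show "\<exists>A. countable A \<and> A \<subseteq> underS r i \<and> (\<forall>z\<in>Field r. A \<subseteq> underS r z \<longrightarrow> N i \<in> T z)"
    proof (cases "\<Y> i = {}")
      case True
      then show ?thesis
        by (intro exI[of _ "{}"]) (auto simp: N_def T_def)
    next
      case False
      have "\<forall>n. \<exists>F. from_nat_into (\<Y> i) n = \<Inter>(C ` F) \<and> finite F \<and> F \<noteq> {} \<and> F \<subseteq> underS r i"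
      proof
        fix n
        have "from_nat_into (\<Y> i) n \<in> X i"
          using from_nat_into[OF False] \<Y>(1) by (rule subsetD[rotated])
        then show "\<exists>F. from_nat_into (\<Y> i) n = \<Inter>(C ` F) \<and> finite F \<and> F \<noteq> {} \<and> F \<subseteq> underS r i"
          by (auto simp: X_def)
      qed
      then obtain F where "\<forall>n. from_nat_into (\<Y> i) n = \<Inter>(C ` F n) \<and> finite (F n) \<and> F n \<noteq> {} \<and>
          F n \<subseteq> underS r i"
        by (rule choice[THEN exE])
      then have F: "\<And>n. from_nat_into (\<Y> i) n = \<Inter>(C ` F n)" "\<And>n. finite (F n)"
        "\<And>n. F n \<noteq> {}" "\<And>n. F n \<subseteq> underS r i"
        by simp_all
      have range_F: "range (from_nat_into (F n)) = F n" for n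
        using F by (intro range_from_nat_into) (auto intro: countable_finite)
      define s where "s k = from_nat_into (F (fst (prod_decode k))) (snd (prod_decode k))" for k
      have "N i = (\<Union>n. from_nat_into (\<Y> i) n)"
        using range_from_nat_into[OF False \<Y>(2)] by (simp add: N_def)
      also have "\<dots> = (\<Union>n. \<Inter>(C ` range (from_nat_into (F n))))"
        by (simp only: F(1) range_F)
      also have "\<dots> = (\<Union>n. \<Inter>m. C (s (prod_encode (n, m))))"
        by (simp add: s_def image_image)
      finally have N: "N i = (\<Union>n. \<Inter>m. C (s (prod_encode (n, m))))" .
      have "range s \<subseteq> underS r i"
        using from_nat_into[OF F(3)] F(4) unfolding s_def by blast
      moreover have "N i \<in> T z" if "range s \<subseteq> underS r z" for z
        using that unfolding N T_def Func_def by (intro insertI2 imageI) auto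
      ultimately show ?thesis
        by (intro exI[of _ "range s"]) simp
    qed
  qed
  then obtain b where b: "\<And>z. z \<in> Field r \<Longrightarrow> \<exists>i\<in>Field r. N i = b \<and> z \<in> under r i"
    by blast
  define J where "J = {i \<in> Field r. N i = b}"
  have "b \<in> sets M"
    using b inf N_sets by (metis finite.emptyI equals0I)
  have pos: "0 < measure M (\<Inter>(C ` F) - b)" if "finite F" "F \<noteq> {}" "F \<subseteq> J" for F
    using that
  proof (induction "card F" arbitrary: F rule: less_induct)
    case less
    have "F \<subseteq> Field r"
      using less.prems by (auto simp: J_def)
    then obtain m where m: "m \<in> F" "F - {m} \<subseteq> underS r m"
      using well_order_finite_max[OF wo] less.prems by blast
    then have mF: "m \<in> Field r" "N m = b"
      using less.prems by (auto simp: J_def)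
    have "0 < measure M (\<Inter>(C ` F))"
    proof (cases "F = {m}")
      case True
      then show ?thesis
        using C(2)[OF mF(1)] by simp
    next
      case False
      define G where "G = F - {m}"
      have G: "finite G" "G \<noteq> {}" "G \<subseteq> J" "G \<subseteq> underS r m" "card G < card F"
        using less.prems m False card_Diff1_less[OF less.prems(1) m(1)] by (auto simp: G_def)
      then have IH: "0 < measure M (\<Inter>(C ` G) - b)"
        using less.hyps by blast
      \<comment> \<open>If this were null, the intersection over \<open>G\<close> would belong to
        \<open>X m\<close> and so lie in \<open>N m = b\<close> up to a null set, against the
        induction hypothesis.\<close>
      have "measure M (\<Inter>(C ` G) \<inter> C m) \<noteq> 0"
      proof
        assume "measure M (\<Inter>(C ` G) \<inter> C m) = 0"
        then have "\<Inter>(C ` G) \<in> X m"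
          using G by (auto simp: X_def)
        then show False
          using \<Y>(3)[of "\<Inter>(C ` G)" m] IH mF by (simp add: N_def)
      qed
      moreover have "\<Inter>(C ` F) = \<Inter>(C ` G) \<inter> C m"
        using m(1) by (auto simp: G_def)
      ultimately show ?thesis
        by (simp add: zero_less_measure_iff)
    qed
    \<comment> \<open>Since \<open>m\<close> is in \<open>F\<close>, the part of the intersection
      inside \<open>b\<close> lies in \<open>N m \<inter> C m\<close>, which is null. This restores
      the stronger claim about the measure outside \<open>b\<close>.\<close>
    moreover have "measure M (\<Inter>(C ` F) - (N m \<inter> C m)) = measure M (\<Inter>(C ` F))"
      using CF less.prems \<open>F \<subseteq> Field r\<close> N_null mF by (intro measure_Diff_null_set) auto
    moreover have "\<Inter>(C ` F) - (N m \<inter> C m) = \<Inter>(C ` F) - b"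
      using m(1) mF by auto
    ultimately show ?case
      by simp
  qed
  have "0 < measure M (\<Inter>(C ` F))" if "finite F" "F \<noteq> {}" "F \<subseteq> J" for F
  proof -
    have "F \<subseteq> Field r"
      using that by (auto simp: J_def)
    then have "measure M (\<Inter>(C ` F) - b) \<le> measure M (\<Inter>(C ` F))"
      using CF that by (intro finite_measure_mono) auto
    then show ?thesis
      using pos[OF that] by linarith
  qed
  then show ?thesis
    using b by (intro exI[of _ J]) (auto simp: J_def)
qed

section \<open>Non-compactness from a separating family\<close>

lemma strong_limit_Pow:
  fixes r :: "'l rel" and A :: "'a set"
  assumes "strong_limit_cardinal r" and "|A| <o r"
  shows "|Pow A| <o r"
proof -
  have r: "Card_order r"
    using assms(1) by (simp add: strong_limit_cardinal_def)
  \<comment> \<open>The strong limit property speaks of cardinals on the type of \<open>r\<close>,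
    so \<open>A\<close> is first copied into \<open>Field r\<close>.\<close>
  have "|A| \<le>o |Field r|"
    using ordLess_imp_ordLeq[OF assms(2)] ordIso_symmetric[OF card_of_Field_ordIso[OF r]]
    by (rule ordLeq_ordIso_trans)
  then obtain A' where A': "A' \<subseteq> Field r" "|A| =o |A'|"
    unfolding internalize_card_of_ordLeq2[of A "Field r"] by blast
  obtain f where f: "inj_on f A" "f ` A \<subseteq> A'"
    using ordIso_imp_ordLeq[OF A'(2)] card_of_ordLeq[of A A'] by blast
  have "|A'| <o r"
    using ordIso_symmetric[OF A'(2)] assms(2) by (rule ordIso_ordLess_trans)
  then have "ctwo ^c |A'| <o r"
    using assms(1) card_of_Card_order unfolding strong_limit_cardinal_def by blast
  moreover have "|Pow A'| =o ctwo ^c |A'|"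
    unfolding ctwo_def cexp_def Field_card_of by (rule card_of_Pow_Func)
  moreover have "|Pow A| \<le>o |Pow A'|"
    using f by (intro card_of_ordLeqI[where f="\<lambda>X. f ` X"] inj_on_image_Pow) auto
  ultimately show ?thesis
    by (blast intro: ordIso_ordLess_trans ordLeq_ordLess_trans)
qed

lemma (in wo_rel) not_in_rel:
  assumes "a \<in> Field r" and "b \<in> Field r" and "\<not> (a \<noteq> b \<and> (a, b) \<in> r)"
  shows "(b, a) \<in> r"
  using assms TOTALS by blast

text \<open>\<open>cofinal\<close> asks for strictly larger elements. Its failure for the small set
  \<open>S\<close> gives an \<open>l\<close> with nothing of \<open>S\<close> strictly above it,
  which by totality is an upper bound.\<close>

lemma is_cofinality_unbounded:
  assumes "Well_order r" and "is_cofinality k r" and "S \<subseteq> Field r" and "|S| <o k"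
  shows "\<exists>l\<in>Field r. \<forall>s\<in>S. (s, l) \<in> r"
proof -
  have "\<not> cofinal S r"
    using assms not_ordLess_ordLeq unfolding is_cofinality_def by blast
  then obtain l where "l \<in> Field r" "\<And>s. s \<in> S \<Longrightarrow> \<not> (l \<noteq> s \<and> (l, s) \<in> r)"
    unfolding cofinal_def by blast
  then show ?thesis
    using assms(1,3) wo_rel.not_in_rel[of r l] unfolding wo_rel_def by blast
qed

text \<open>A finite cofinal set would have a maximum, but strict cofinality puts another of its
  elements above that.\<close>

lemma is_cofinality_infinite:
  assumes "Card_order r" and "infinite (Field r)" and "is_cofinality k r"
  shows "infinite (Field k)"
proof
  have wo: "Well_order r"
    using assms(1) by (rule card_order_on_well_order_on)
  obtain K where K: "K \<subseteq> Field r" "cofinal K r" "|K| =o k" "Card_order k"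
    using assms(3) unfolding is_cofinality_def by blast
  assume "finite (Field k)"
  then have "finite K"
    using card_of_ordIso_finite[of K "Field k"] ordIso_transitive[OF K(3)
        ordIso_symmetric[OF card_of_Field_ordIso[OF K(4)]]] by blast
  have "K \<noteq> {}"
    using K(2) assms(2) unfolding cofinal_def by (metis empty_iff finite.emptyI ex_in_conv)
  obtain m where m: "m \<in> K" "K - {m} \<subseteq> underS r m"
    using well_order_finite_max[OF wo \<open>finite K\<close> \<open>K \<noteq> {}\<close> K(1)] by blast
  obtain b where "b \<in> K" "m \<noteq> b" "(m, b) \<in> r"
    using K(1,2) m(1) unfolding cofinal_def by blast
  then show False
    using m(2) wo_rel.ANTISYM[of r] wo unfolding wo_rel_def underS_def by (auto dest: antisymD)
qed

lemma card_of_under_ordLess: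
  assumes "Card_order r" and "infinite (Field r)" and "a \<in> Field r"
  shows "|under r a| <o r"
proof -
  have "|underS r a \<union> {a}| <o r"
    using assms
    by (intro card_of_Un_ordLess_infinite_Field[OF assms(2,1) card_of_underS[OF assms(1,3)]])
      (simp add: finite_ordLess_Card_order)
  moreover have "|under r a| \<le>o |underS r a \<union> {a}|"
    by (intro card_of_mono1) (auto simp: under_def underS_def)
  ultimately show ?thesis
    by (rule ordLeq_ordLess_trans[rotated])
qed

text \<open>The measure-theoretic core of the argument. Of a Loeb space it uses that the digits
  \<open>B k\<close> separate points and that two distinct digits disagree on a set of positive
  measure.\<close>

lemma not_compact_of_separating_family:
  fixes lam :: "'l rel" and kap :: "'k rel" and M :: "'a measure" and B :: "'b \<Rightarrow> 'a set"
  assumes lam: "strong_limit_cardinal lam"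
    and kap: "is_cofinality kap lam"
    and kap_power: "\<And>\<mu> :: 'k rel. Card_order \<mu> \<Longrightarrow> \<mu> <o kap \<Longrightarrow> \<mu> ^c natLeq <o kap"
    and M: "finite_measure M"
    and space: "|space M| =o lam"
    and separating: "\<And>x y. x \<in> space M \<Longrightarrow> y \<in> space M \<Longrightarrow>
      (\<And>k. k \<in> I \<Longrightarrow> x \<in> B k \<longleftrightarrow> y \<in> B k) \<Longrightarrow> x = y"
    and different: "\<And>p q. p \<in> I \<Longrightarrow> q \<in> I \<Longrightarrow> p \<noteq> q \<Longrightarrow>
      \<exists>E\<in>sets M. 0 < measure M E \<and> (\<forall>x\<in>E. x \<in> B p \<longleftrightarrow> x \<notin> B q)"
  shows "\<not> compact_measure_space M"
proof
  interpret finite_measure M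
    by (rule M)
  assume "compact_measure_space M"
  then obtain \<C> where \<C>: "\<C> \<subseteq> sets M" "compact_family \<C>" "inner_regular_family M \<C>"
    unfolding compact_measure_space_def by blast
  have lam_card: "Card_order lam" and lam_inf: "infinite (Field lam)"
    using lam by (auto simp: strong_limit_cardinal_def cinfinite_def)
  have lam_wo: "Well_order lam"
    using lam_card by (rule card_order_on_well_order_on)
  have kap_card: "Card_order kap"
    using kap by (simp add: is_cofinality_def)
  have kap_wo: "Well_order kap"
    using kap_card by (rule card_order_on_well_order_on)
  have kap_inf: "infinite (Field kap)"
    using lam_card lam_inf kap by (rule is_cofinality_infinite)
  have lam_wr: "wo_rel lam" and kap_wr: "wo_rel kap"
    using lam_wo kap_wo by (simp_all add: wo_rel_def)
  have lam_trans: "(a, c) \<in> lam" if "(a, b) \<in> lam" "(b, c) \<in> lam" for a b c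
    using wo_rel.TRANS[OF lam_wr] that by (rule transD)

  have "lam \<le>o |I|"
  proof (rule ccontr)
    assume "\<not> lam \<le>o |I|"
    then have "|I| <o lam"
      using not_ordLeq_iff_ordLess[OF card_of_Well_order lam_wo] by blast
    then have "|Pow I| <o lam"
      by (rule strong_limit_Pow[OF lam])
    moreover have "|space M| \<le>o |Pow I|"
      by (rule card_of_ordLeqI[where f="\<lambda>x. {k \<in> I. x \<in> B k}"])
        (auto intro!: inj_onI separating)
    ultimately show False
      using space not_ordLess_ordIso ordLeq_ordLess_trans by blast
  qed
  have avoid: "\<exists>E\<in>sets M. 0 < measure M E \<and> E \<inter> Y = {}" if "|Y| <o lam" for Y
  proof -
    have "|(\<lambda>k. B k \<inter> Y) ` I| \<le>o |Pow Y|"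
      by (intro card_of_mono1) auto
    then have "|(\<lambda>k. B k \<inter> Y) ` I| <o |I|"
      using strong_limit_Pow[OF lam that] \<open>lam \<le>o |I|\<close>
      by (meson ordLeq_ordLess_trans ordLess_ordLeq_trans)
    then have "\<not> inj_on (\<lambda>k. B k \<inter> Y) I"
      by (meson card_of_ordLeqI imageI not_ordLess_ordLeq)
    then obtain p q where pq: "p \<in> I" "q \<in> I" "p \<noteq> q" "B p \<inter> Y = B q \<inter> Y"
      by (auto simp: inj_on_def)
    then show ?thesis
      using different[OF pq(1-3)] by blast
  qed

  obtain K where K: "K \<subseteq> Field lam" "cofinal K lam" "|K| =o kap"
    using kap unfolding is_cofinality_def by blast
  have "|Field kap| =o |K|"
    using card_of_Field_ordIso[OF kap_card] ordIso_symmetric[OF K(3)] by (rule ordIso_transitive)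
  then obtain b where b: "bij_betw b (Field kap) K"
    using card_of_ordIso by blast
  have bF: "b i \<in> Field lam" if "i \<in> Field kap" for i
    using b K(1) that by (auto simp: bij_betw_def)
  have "|space M| =o |Field lam|"
    using space ordIso_symmetric[OF card_of_Field_ordIso[OF lam_card]] by (rule ordIso_transitive)
  then obtain g where g: "bij_betw g (space M) (Field lam)"
    using card_of_ordIso by blast
  \<comment> \<open>The enumeration \<open>b\<close> of the cofinal set is just a bijection, so its
    values are bounded over whole initial segments of \<open>kap\<close>, not one at a time.\<close>
  have "\<exists>l\<in>Field lam. \<forall>j\<in>under kap i. (b j, l) \<in> lam" if "i \<in> Field kap" for i
  proof -
    have "|b ` under kap i| <o kap"
      using card_of_image card_of_under_ordLess[OF kap_card kap_inf that]
      by (rule ordLeq_ordLess_trans)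
    moreover have "b ` under kap i \<subseteq> Field lam"
      using bF by (auto simp: under_def Field_def)
    ultimately show ?thesis
      using is_cofinality_unbounded[OF lam_wo kap, of "b ` under kap i"] by blast
  qed
  then obtain l where l: "\<And>i. i \<in> Field kap \<Longrightarrow> l i \<in> Field lam"
    "\<And>i j. i \<in> Field kap \<Longrightarrow> j \<in> under kap i \<Longrightarrow> (b j, l i) \<in> lam"
    by metis
  \<comment> \<open>Through \<open>g\<close>, the set \<open>Y i\<close> lands in the initial
    segment of \<open>lam\<close> up to \<open>l i\<close>, so it is small; cofinality of
    \<open>K\<close> makes these sets exhaust the space.\<close>
  define Y where "Y i = {x \<in> space M. \<exists>j\<in>under kap i. (g x, b j) \<in> lam}" for i
  have Y_small: "|Y i| <o lam" if "i \<in> Field kap" for i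
  proof -
    have "g ` Y i \<subseteq> under lam (l i)"
      using l(2)[OF that] lam_trans by (fastforce simp: Y_def under_def)
    moreover have "inj_on g (Y i)"
      using g by (auto simp: Y_def bij_betw_def intro: inj_on_subset)
    ultimately have "|Y i| \<le>o |under lam (l i)|"
      by (intro card_of_ordLeqI[where f=g]) auto
    then show ?thesis
      using card_of_under_ordLess[OF lam_card lam_inf l(1)[OF that]] by (rule ordLeq_ordLess_trans)
  qed
  have Y_mono: "Y i \<subseteq> Y j" if "i \<in> under kap j" for i j
    using that wo_rel.TRANS[OF kap_wr] by (fastforce simp: Y_def under_def dest: transD)
  have Y_cover: "\<exists>i\<in>Field kap. x \<in> Y i" if "x \<in> space M" for x
  proof -
    have "g x \<in> Field lam"
      using g that by (auto simp: bij_betw_def)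
    then obtain k where "k \<in> K" "(g x, k) \<in> lam"
      using K(2) unfolding cofinal_def by blast
    moreover obtain i where "i \<in> Field kap" "b i = k"
      using b \<open>k \<in> K\<close> by (auto simp: bij_betw_def)
    moreover have "(i, i) \<in> kap"
      using wo_rel.REFL[OF kap_wr] \<open>i \<in> Field kap\<close> by (auto dest: refl_onD)
    ultimately show ?thesis
      using that by (auto simp: Y_def under_def)
  qed
  \<comment> \<open>A positive supremum in inner regularity forces a member of positive measure
    inside the set that avoids \<open>Y i\<close>.\<close>
  have "\<exists>C. C \<in> \<C> \<and> C \<inter> Y i = {} \<and> 0 < measure M C" if i: "i \<in> Field kap" for i
  proof -
    obtain E where E: "E \<in> sets M" "0 < measure M E" "E \<inter> Y i = {}"
      using avoid[OF Y_small[OF i]] by blast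
    moreover have "emeasure M E = (SUP C\<in>{C \<in> \<C>. C \<subseteq> E}. emeasure M C)"
      using \<C>(3) E(1) unfolding inner_regular_family_def by blast
    moreover have "0 < emeasure M E"
      using E(2) by (simp add: emeasure_eq_measure)
    ultimately have "0 < (SUP C\<in>{C \<in> \<C>. C \<subseteq> E}. emeasure M C)"
      by simp
    then obtain C where "C \<in> \<C>" "C \<subseteq> E" "0 < emeasure M C"
      by (auto simp: less_SUP_iff)
    then show ?thesis
      using E by (auto simp: emeasure_eq_measure)
  qed
  then obtain C where C: "\<And>i. i \<in> Field kap \<Longrightarrow> C i \<in> \<C>"
    "\<And>i. i \<in> Field kap \<Longrightarrow> C i \<inter> Y i = {}" "\<And>i. i \<in> Field kap \<Longrightarrow> 0 < measure M (C i)"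
    by metis

  have "\<exists>J\<subseteq>Field kap. (\<forall>z\<in>Field kap. \<exists>i\<in>J. z \<in> under kap i) \<and>
    (\<forall>F\<subseteq>J. finite F \<longrightarrow> F \<noteq> {} \<longrightarrow> 0 < measure M (\<Inter>i\<in>F. C i))"
  proof (rule caliber[OF kap_card kap_inf])
    fix S assume S: "S \<subseteq> Field kap" "|S| <o kap"
    have "|l ` S| <o kap"
      using card_of_image S(2) by (rule ordLeq_ordLess_trans)
    then obtain c where c: "c \<in> Field lam" "\<And>i. i \<in> S \<Longrightarrow> (l i, c) \<in> lam"
      using is_cofinality_unbounded[OF lam_wo kap, of "l ` S"] S(1) l(1) by blast
    then obtain k where k: "k \<in> K" "c \<noteq> k" "(c, k) \<in> lam"
      using K(2) unfolding cofinal_def by blast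
    then obtain z where z: "z \<in> Field kap" "b z = k"
      using b by (auto simp: bij_betw_def)
    \<comment> \<open>This is regularity of the cofinality. If \<open>z\<close> were at most some
      \<open>i\<close> in \<open>S\<close>, then \<open>k = b z\<close> would be at most
      \<open>l i\<close>, hence at most \<open>c\<close>, although \<open>k\<close> was chosen
      strictly above \<open>c\<close>.\<close>
    have "i \<in> underS kap z" if "i \<in> S" for i
    proof (rule ccontr)
      assume "i \<notin> underS kap z"
      then have "z \<in> under kap i"
        using wo_rel.not_in_rel[OF kap_wr, of i z] S(1) that z(1) by (auto simp: underS_def under_def)
      then have "(k, c) \<in> lam"
        using l(2)[of i z] S(1) that z(2) c(2) lam_trans by blast
      then show False
        using k wo_rel.ANTISYM[OF lam_wr] by (auto dest: antisymD)
    qed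
    then show "\<exists>z\<in>Field kap. S \<subseteq> underS kap z"
      using z(1) by blast
  next
    fix A :: "'k set" assume "|A| <o kap"
    then show "|Func (UNIV :: nat set) A| <o kap"
      using kap_power[OF card_of_Card_order] by (simp add: cexp_def Field_natLeq Field_card_of)
  qed (use C \<C>(1) in auto)
  then obtain J where "J \<subseteq> Field kap \<and> (\<forall>z\<in>Field kap. \<exists>i\<in>J. z \<in> under kap i) \<and>
    (\<forall>F\<subseteq>J. finite F \<longrightarrow> F \<noteq> {} \<longrightarrow> 0 < measure M (\<Inter>i\<in>F. C i))"
    by (rule exE)
  then have J: "J \<subseteq> Field kap" "\<And>z. z \<in> Field kap \<Longrightarrow> \<exists>i\<in>J. z \<in> under kap i"
    "\<And>F. F \<subseteq> J \<Longrightarrow> finite F \<Longrightarrow> F \<noteq> {} \<Longrightarrow> 0 < measure M (\<Inter>i\<in>F. C i)"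
    by simp_all
  have "fip (C ` J)"
    unfolding fip_def
  proof (intro allI impI)
    fix \<F> assume "\<F> \<subseteq> C ` J" "finite \<F>"
    then obtain F where F: "F \<subseteq> J" "finite F" "\<F> = C ` F"
      by (meson finite_subset_image)
    then show "\<Inter>\<F> \<noteq> {}"
      using J(3)[of F] by (cases "F = {}") auto
  qed
  moreover have "C ` J \<subseteq> \<C>"
    using C(1) J(1) by auto
  ultimately have "\<Inter>(C ` J) \<noteq> {}"
    using \<C>(2) by (simp add: compact_family_def)
  then obtain x where x: "\<And>i. i \<in> J \<Longrightarrow> x \<in> C i"
    by auto
  \<comment> \<open>Membership in one measurable \<open>C i0\<close> puts \<open>x\<close> into the
    space, which the sets \<open>Y z\<close> cover.\<close>
  obtain i0 where "i0 \<in> J"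
    using J(2) kap_inf by fastforce
  then have "x \<in> C i0" "C i0 \<in> sets M"
    using x C(1) J(1) \<C>(1) by auto
  then have "x \<in> space M"
    using sets.sets_into_space by blast
  then obtain z where z: "z \<in> Field kap" "x \<in> Y z"
    using Y_cover by blast
  then obtain i where "i \<in> J" "z \<in> under kap i"
    using J(2) by blast
  then have "x \<in> C i \<inter> Y i"
    using Y_mono z(2) x by blast
  then show False
    using C(2) J(1) \<open>i \<in> J\<close> by auto
qed

section \<open>Superstructures\<close>

definition FAll :: "nat \<Rightarrow> fm \<Rightarrow> fm" where
  "FAll i p = FNeg (FEx i (FNeg p))"

definition FImp :: "fm \<Rightarrow> fm \<Rightarrow> fm" where
  "FImp p q = FNeg (FConj p (FNeg q))"

definition FDisj :: "fm \<Rightarrow> fm \<Rightarrow> fm" where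
  "FDisj p q = FNeg (FConj (FNeg p) (FNeg q))"

definition FIff :: "fm \<Rightarrow> fm \<Rightarrow> fm" where
  "FIff p q = FConj (FImp p q) (FImp q p)"

lemma sat_connectives [simp]:
  "sat E (FAll i p) e \<longleftrightarrow> (\<forall>x. sat E p (e(i := x)))"
  "sat E (FImp p q) e \<longleftrightarrow> (sat E p e \<longrightarrow> sat E q e)"
  "sat E (FDisj p q) e \<longleftrightarrow> sat E p e \<or> sat E q e"
  "sat E (FIff p q) e \<longleftrightarrow> (sat E p e \<longleftrightarrow> sat E q e)"
  by (auto simp: FAll_def FImp_def FDisj_def FIff_def)

text \<open>The bound variables are larger than, hence distinct from, all the free ones.\<close>

definition FPair :: "nat \<Rightarrow> nat \<Rightarrow> nat \<Rightarrow> fm" where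
  "FPair p x y = (let s = p + x + y + 1; t = p + x + y + 2; z = p + x + y + 3 in
     FEx s (FEx t
       (FConj (FAll z (FIff (FMem z s) (FEq z x)))
       (FConj (FAll z (FIff (FMem z t) (FDisj (FEq z x) (FEq z y))))
              (FAll z (FIff (FMem z p) (FDisj (FEq z s) (FEq z t))))))))"

definition FRel :: "nat \<Rightarrow> nat \<Rightarrow> nat \<Rightarrow> fm" where
  "FRel r x y = (let p = r + x + y + 1 in FEx p (FConj (FPair p x y) (FMem p r)))"

lemma sat_FPair [simp]: "sat E (FPair p x y) e \<longleftrightarrow> is_pair E (e p) (e x) (e y)"
  by (simp add: FPair_def is_pair_def Let_def)

lemma sat_FRel [simp]: "sat E (FRel r x y) e \<longleftrightarrow> related E (e r) (e x) (e y)"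
  by (simp add: FRel_def related_def Let_def)

lemma is_pair_inject:
  assumes "is_pair E p x y" and "is_pair E p x' y'"
  shows "x = x'" and "y = y'"
proof -
  obtain s t where s: "\<And>z. E z s \<longleftrightarrow> z = x" and t: "\<And>z. E z t \<longleftrightarrow> z = x \<or> z = y"
    and p: "\<And>z. E z p \<longleftrightarrow> z = s \<or> z = t"
    using assms(1) unfolding is_pair_def by auto
  obtain s' t' where s': "\<And>z. E z s' \<longleftrightarrow> z = x'" and t': "\<And>z. E z t' \<longleftrightarrow> z = x' \<or> z = y'"
    and p': "\<And>z. E z p \<longleftrightarrow> z = s' \<or> z = t'"
    using assms(2) unfolding is_pair_def by auto
  have "s' = s \<or> s' = t" "t' = s \<or> t' = t" "s = s' \<or> s = t'" "t = s' \<or> t = t'"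
    using p p' by blast+
  then show "x = x'" "y = y'"
    using s t s' t' by metis+
qed

lemma rank_level_mono: "m \<le> n \<Longrightarrow> rank_level B E m \<subseteq> rank_level B E n"
  by (induction n) (auto simp: le_Suc_eq)

section \<open>Sets and graphs coded in the standard superstructure\<close>

context superstructure
begin

lemma members_rank:
  obtains n where "{y. mem y x} \<subseteq> rank_level (range atom) mem n"
proof -
  obtain n where "x \<in> rank_level (range atom) mem n"
    using finite_rank by blast
  then have "\<exists>n. {y. mem y x} \<subseteq> rank_level (range atom) mem n"
    by (induction n) (auto simp: atom_memberless)
  then show ?thesis
    using that by blast
qed

text \<open>Bounded rank is what makes \<open>mk_set\<close> meaningful: it gives existence, while
  extensionality gives uniqueness among non-atoms, so the empty set is not confused with an
  atom.\<close>

lemma mem_mk_set: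
  assumes "A \<subseteq> rank_level (range atom) mem n"
  shows "mem y (mk_set A) \<longleftrightarrow> y \<in> A"
proof -
  have "\<exists>!x. x \<notin> range atom \<and> {y. mem y x} = A"
  proof (rule ex_ex1I)
    show "\<exists>x. x \<notin> range atom \<and> {y. mem y x} = A"
      using all_subsets[OF assms] .
    show "x = x'" if "x \<notin> range atom \<and> {y. mem y x} = A" "x' \<notin> range atom \<and> {y. mem y x'} = A"
      for x x'
      using extensionality[of x x'] that by blast
  qed
  from theI'[OF this] show ?thesis
    unfolding mk_set_def by auto
qed

lemma pair_exists:
  assumes "x \<in> rank_level (range atom) mem n" and "y \<in> rank_level (range atom) mem n"
  shows "\<exists>p. is_pair mem p x y"
proof -
  have s: "mem z (mk_set {x}) \<longleftrightarrow> z = x" for z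
    using mem_mk_set[of "{x}" n z] assms by simp
  have t: "mem z (mk_set {x, y}) \<longleftrightarrow> z = x \<or> z = y" for z
    using mem_mk_set[of "{x, y}" n z] assms by simp
  have "{mk_set {x}, mk_set {x, y}} \<subseteq> rank_level (range atom) mem (Suc n)"
    using assms s t by auto
  from mem_mk_set[OF this] show ?thesis
    unfolding is_pair_def using s t by blast
qed

text \<open>Each layer of braces costs one level. This bounds the ranks of \<open>nat_rel\<close>
  and \<open>card_graph\<close>, so that both have the intended members.\<close>

lemma pair_rank:
  assumes "is_pair mem p x y"
    and "x \<in> rank_level (range atom) mem n" and "y \<in> rank_level (range atom) mem n"
  shows "p \<in> rank_level (range atom) mem (Suc (Suc n))"
proof -
  obtain s t where s: "\<And>z. mem z s \<longleftrightarrow> z = x" and t: "\<And>z. mem z t \<longleftrightarrow> z = x \<or> z = y"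
    and p: "\<And>z. mem z p \<longleftrightarrow> z = s \<or> z = t"
    using assms(1) unfolding is_pair_def by auto
  have "s \<in> rank_level (range atom) mem (Suc n)" "t \<in> rank_level (range atom) mem (Suc n)"
    using s t assms(2,3) by auto
  then show ?thesis
    using p by auto
qed

lemma mem_nat_set [simp]: "mem z nat_set \<longleftrightarrow> z \<in> range atom"
  unfolding nat_set_def by (rule mem_mk_set[of _ 0]) simp

lemma mem_mk_set_atoms [simp]: "mem z (mk_set (atom ` A)) \<longleftrightarrow> z \<in> atom ` A"
  by (rule mem_mk_set[of _ 0]) auto

lemma mk_set_atoms_rank: "mk_set (atom ` A) \<in> rank_level (range atom) mem 1"
  by auto

lemma atom_rank: "atom n \<in> rank_level (range atom) mem k"
  using rank_level_mono[of 0 k "range atom" mem] by auto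

lemma atom_eq_iff [simp]: "atom m = atom n \<longleftrightarrow> m = n"
  using inj_atom by (simp add: inj_eq)

lemma related_nat_rel [simp]:
  "related mem (nat_rel R) x y \<longleftrightarrow> (\<exists>m n. x = atom m \<and> y = atom n \<and> R m n)"
proof -
  let ?S = "{p. \<exists>m n. R m n \<and> is_pair mem p (atom m) (atom n)}"
  have "?S \<subseteq> rank_level (range atom) mem 2"
    using pair_rank[of _ _ _ 0] by (auto simp: numeral_2_eq_2 simp del: rank_level.simps(2))
  then have "mem p (nat_rel R) \<longleftrightarrow> (\<exists>m n. R m n \<and> is_pair mem p (atom m) (atom n))" for p
    unfolding nat_rel_def by (subst mem_mk_set) auto
  note mem = this
  show ?thesis
  proof
    assume "related mem (nat_rel R) x y"
    then obtain p m n where "is_pair mem p x y" "R m n" "is_pair mem p (atom m) (atom n)"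
      unfolding related_def mem by blast
    then show "\<exists>m n. x = atom m \<and> y = atom n \<and> R m n"
      using is_pair_inject by metis
  next
    assume "\<exists>m n. x = atom m \<and> y = atom n \<and> R m n"
    then obtain m n where "x = atom m" "y = atom n" "R m n"
      by blast
    moreover obtain p where "is_pair mem p (atom m) (atom n)"
      using pair_exists[OF atom_rank[of m 0] atom_rank[of n 0]] by blast
    ultimately show "related mem (nat_rel R) x y"
      unfolding related_def mem by blast
  qed
qed

lemma related_card_graph [simp]:
  "related mem card_graph s a \<longleftrightarrow> (\<exists>A. finite A \<and> s = mk_set (atom ` A) \<and> a = atom (card A))"
proof -
  let ?S = "{p. \<exists>A. finite A \<and> is_pair mem p (mk_set (atom ` A)) (atom (card A))}"
  have "?S \<subseteq> rank_level (range atom) mem 3"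
    using pair_rank[OF _ mk_set_atoms_rank atom_rank]
    by (auto simp: numeral_3_eq_3 simp del: rank_level.simps(2))
  then have "mem p card_graph \<longleftrightarrow> (\<exists>A. finite A \<and> is_pair mem p (mk_set (atom ` A)) (atom (card A)))"
    for p
    unfolding card_graph_def by (subst mem_mk_set) auto
  note mem = this
  show ?thesis
  proof
    assume "related mem card_graph s a"
    then obtain p A where "is_pair mem p s a" "finite A"
      "is_pair mem p (mk_set (atom ` A)) (atom (card A))"
      unfolding related_def mem by blast
    then show "\<exists>A. finite A \<and> s = mk_set (atom ` A) \<and> a = atom (card A)"
      using is_pair_inject by metis
  next
    assume "\<exists>A. finite A \<and> s = mk_set (atom ` A) \<and> a = atom (card A)"
    then obtain A where "finite A" "s = mk_set (atom ` A)" "a = atom (card A)"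
      by blast
    moreover obtain p where "is_pair mem p (mk_set (atom ` A)) (atom (card A))"
      using pair_exists[OF mk_set_atoms_rank atom_rank] by blast
    ultimately show "related mem card_graph s a"
      unfolding related_def mem by blast
  qed
qed

text \<open>Separation for arbitrary subsets of the standard universe, from which the comprehension
  principles for internal sets are transferred.\<close>

lemma subset_exists:
  assumes "A \<subseteq> {y. mem y x}"
  shows "\<exists>u. \<forall>z. mem z u \<longleftrightarrow> z \<in> A"
proof -
  obtain n where "{y. mem y x} \<subseteq> rank_level (range atom) mem n"
    by (rule members_rank)
  then show ?thesis
    using all_subsets[of A n] assms by blast
qed

end

section \<open>Transfer\<close>

lemma card_involution_half:
  fixes f :: "nat \<Rightarrow> nat"
  assumes "\<And>x. x < N \<Longrightarrow> f x < N" and "\<And>x. f (f x) = x" and "\<And>x. D (f x) \<longleftrightarrow> \<not> D x"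
  shows "2 * card {x. x < N \<and> D x} = N"
proof -
  have "card {x. x < N \<and> D x} = card {x. x < N \<and> \<not> D x}"
    using assms by (intro bij_betw_same_card[of f] bij_betw_byWitness[where f'=f]) auto
  moreover have "{x. x < N \<and> D x} \<union> {x. x < N \<and> \<not> D x} = {..<N}"
    by auto
  moreover have "card ({x. x < N \<and> D x} \<union> {x. x < N \<and> \<not> D x}) =
      card {x. x < N \<and> D x} + card {x. x < N \<and> \<not> D x}"
    by (rule card_Un_disjoint) auto
  ultimately show ?thesis
    by simp
qed

text \<open>Flipping digit \<open>j\<close> stays within a block of length \<open>2 ^ Suc j\<close>,
  and \<open>N\<close> is a union of such blocks.\<close>

lemma flip_bit_less:
  assumes "2 ^ Suc j dvd N" and "x < N"
  shows "flip_bit j x < (N :: nat)"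
proof -
  have "drop_bit (Suc j) (flip_bit j x) = drop_bit (Suc j) x"
    by (rule bit_eqI) (auto simp: bit_simps)
  then have "flip_bit j x div 2 ^ Suc j = x div 2 ^ Suc j"
    by (simp only: drop_bit_eq_div)
  then show ?thesis
    using assms by (metis dvd_div_mult_self less_mult_imp_div_less div_less_iff_less_mult
        zero_less_power zero_less_numeral)
qed

text \<open>Flipping one of the two digits toggles disagreement, so exactly half of the numbers
  below a suitable \<open>N\<close> disagree. An \<open>N\<close> with
  \<open>N \<le> n < 2 * N\<close> loses another factor of two, hence the quarter.\<close>

lemma card_bits_differ:
  fixes n p q :: nat
  assumes "p < q" and "2 ^ q \<le> n"
  shows "n \<le> 4 * card {x \<in> {1..n}. bit x p \<noteq> bit x q}"
proof -
  define D where "D x \<longleftrightarrow> bit x p \<noteq> bit x q" for x :: nat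
  have flip: "D (flip_bit j x) \<longleftrightarrow> \<not> D x" if "j = p \<or> j = q" for j x
    using that assms(1) by (auto simp: D_def bit_simps)
  have flip2: "flip_bit j (flip_bit j x) = x" for j and x :: nat
    by (rule bit_eqI) (auto simp: bit_simps)
  have half: "2 * card {x. x < N \<and> D x} = N" if "2 ^ Suc j dvd N" "j = p \<or> j = q" for N j
    using that by (intro card_involution_half[of N "flip_bit j"] flip_bit_less flip2 flip)
  \<comment> \<open>If \<open>n < 2 ^ Suc q\<close>, take \<open>N = 2 ^ q\<close> and flip digit
    \<open>p\<close>; otherwise take the largest multiple of \<open>2 ^ Suc q\<close> up to
    \<open>n\<close> and flip digit \<open>q\<close>.\<close>
  have "\<exists>N\<le>n. n < 2 * N \<and> 2 * card {x. x < N \<and> D x} = N"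
  proof (cases "n < 2 ^ Suc q")
    case True
    then show ?thesis
      using assms half[OF le_imp_power_dvd[of "Suc p" q 2]] by (intro exI[of _ "2 ^ q"]) auto
  next
    case False
    let ?N = "2 ^ Suc q * (n div 2 ^ Suc q)"
    have "n mod 2 ^ Suc q < 2 ^ Suc q"
      by simp
    moreover have "2 ^ Suc q \<le> ?N"
      using False mult_le_mono2[of 1 "n div 2 ^ Suc q" "2 ^ Suc q"]
      by (simp add: Suc_le_eq div_greater_zero_iff)
    moreover have "n = ?N + n mod 2 ^ Suc q"
      by (simp only: mult_div_mod_eq)
    ultimately have "?N \<le> n \<and> n < 2 * ?N"
      by linarith
    then show ?thesis
      using half[of q ?N] by (intro exI[of _ ?N]) simp
  qed
  then obtain N where N: "N \<le> n" "n < 2 * N" "2 * card {x. x < N \<and> D x} = N"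
    by blast
  \<comment> \<open>The count started at 0 and the range wanted starts at 1; all digits of 0 agree,
    so nothing is lost.\<close>
  have "x \<noteq> 0" if "D x" for x
    using that by (cases "x = 0") (auto simp: D_def)
  then have "{x. x < N \<and> D x} \<subseteq> {x \<in> {1..n}. bit x p \<noteq> bit x q}"
    using N(1) by (auto simp: D_def Suc_le_eq)
  then have "card {x. x < N \<and> D x} \<le> card {x \<in> {1..n}. bit x p \<noteq> bit x q}"
    by (intro card_mono) auto
  then show ?thesis
    using N by linarith
qed

text \<open>The digits with \<open>2 ^ k > n\<close> vanish in both numbers.\<close>

lemma bits_determine:
  fixes x y n :: nat
  assumes "x \<le> n" and "y \<le> n" and "\<And>k. 2 ^ k \<le> n \<Longrightarrow> bit x k \<longleftrightarrow> bit y k"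
  shows "x = y"
proof (rule bit_eqI)
  have high: "\<not> bit z k" if "z \<le> n" "\<not> 2 ^ k \<le> n" for z k :: nat
    using that by (simp add: bit_iff_odd)
  show "bit x k \<longleftrightarrow> bit y k" for k
    using assms high by (cases "2 ^ k \<le> n") auto
qed

section \<open>Transferred facts about internal sets, counting and digits\<close>

context elementary_extension
begin

text \<open>In most uses the first variables are evaluated at standard constants listed in the
  environment. \<open>FAll\<close> binds all parameters, so arbitrary nonstandard objects can be put
  in after transfer.\<close>

lemma transfer: "sat mem p e \<Longrightarrow> sat smem p (star \<circ> e)"
  using elementary unfolding elementary_embedding_def by blast

lemma extent_Diff: "\<exists>u. \<forall>z. smem z u \<longleftrightarrow> smem z s \<and> \<not> smem z t"
proof -
  have "\<exists>u. \<forall>z. mem z u \<longleftrightarrow> mem z s \<and> \<not> mem z t" for s t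
    using subset_exists[of "{z. mem z s \<and> \<not> mem z t}" s] by auto
  then have "sat mem (FAll 0 (FAll 1 (FEx 2 (FAll 3
      (FIff (FMem 3 2) (FConj (FMem 3 0) (FNeg (FMem 3 1)))))))) e" for e
    by simp
  from transfer[OF this] show ?thesis
    by simp
qed

lemma extent_initial_segment:
  assumes "h \<in> hypernats"
  shows "\<exists>u. \<forall>z. smem z u \<longleftrightarrow> z \<in> initial_segment h"
proof -
  let ?le = "nat_rel (\<le>)"
  have "\<exists>u. \<forall>z. mem z u \<longleftrightarrow> mem z nat_set \<and> related mem ?le (atom 1) z \<and> related mem ?le z h" for h
    by (rule exE[OF subset_exists[of "{z. mem z nat_set \<and> related mem ?le (atom 1) z \<and> related mem ?le z h}" nat_set]])
      (auto simp del: related_nat_rel)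
  then have "sat mem (FAll 3 (FEx 4 (FAll 5 (FIff (FMem 5 4)
      (FConj (FMem 5 0) (FConj (FRel 1 2 5) (FRel 1 5 3))))))) ((!) [nat_set, ?le, atom 1])"
    by (simp del: related_nat_rel mem_nat_set)
  from transfer[OF this] show ?thesis
    by (simp add: initial_segment_def hypernats_def star_rel_def)
qed

lemma star_rel_hypernats:
  assumes "star_rel R a b"
  shows "a \<in> hypernats" and "b \<in> hypernats"
proof -
  have "sat mem (FAll 2 (FAll 3 (FImp (FRel 1 2 3) (FConj (FMem 2 0) (FMem 3 0)))))
      ((!) [nat_set, nat_rel R])"
    by auto
  from transfer[OF this] show "a \<in> hypernats" "b \<in> hypernats"
    using assms by (auto simp: hypernats_def star_rel_def)
qed

lemma star_rel_mono2:
  assumes "star_rel R a b" and "star_rel R' a b" and "\<And>m n. R m n \<Longrightarrow> R' m n \<Longrightarrow> R'' m n"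
  shows "star_rel R'' a b"
proof -
  have "sat mem (FAll 3 (FAll 4 (FImp (FRel 0 3 4) (FImp (FRel 1 3 4) (FRel 2 3 4)))))
      ((!) [nat_rel R, nat_rel R', nat_rel R''])"
    using assms(3) by auto
  from transfer[OF this] show ?thesis
    using assms(1,2) by (simp add: star_rel_def)
qed

lemma star_rel_mono:
  assumes "star_rel R a b" and "\<And>m n. R m n \<Longrightarrow> R' m n"
  shows "star_rel R' a b"
  using star_rel_mono2[OF assms(1,1)] assms(2) by blast

lemma star_rel_total:
  assumes "a \<in> hypernats" and "b \<in> hypernats"
  shows "star_rel R a b \<or> star_rel (\<lambda>m n. \<not> R m n) a b"
proof -
  have "sat mem (FAll 3 (FAll 4 (FImp (FMem 3 0) (FImp (FMem 4 0) (FDisj (FRel 1 3 4) (FRel 2 3 4))))))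
      ((!) [nat_set, nat_rel R, nat_rel (\<lambda>m n. \<not> R m n)])"
    by auto
  from transfer[OF this] show ?thesis
    using assms by (simp add: star_rel_def hypernats_def)
qed

text \<open>Relations disjoint on the naturals stay disjoint after transfer. Claims about
  hypernatural quotients can thus be refuted by real arithmetic at a standard pair.\<close>

lemma star_rel_consistent:
  assumes "star_rel R a b" and "star_rel R' a b"
  obtains m n where "R m n" and "R' m n"
proof -
  have "\<exists>m n. R m n \<and> R' m n"
  proof (rule ccontr)
    assume "\<not> ?thesis"
    then have "sat mem (FAll 2 (FAll 3 (FNeg (FConj (FRel 0 2 3) (FRel 1 2 3)))))
        ((!) [nat_rel R, nat_rel R'])"
      by auto
    from transfer[OF this] show False
      using assms by (simp add: star_rel_def)
  qed
  then show ?thesis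
    using that by blast
qed

text \<open>Only the extents of \<open>s\<close> and \<open>t\<close> are compared, because
  \<open>internal_card\<close> is a function of the external set of members and must not depend on
  the code chosen for it.\<close>

lemma card_graph_unique:
  assumes "\<And>z. smem z s \<longleftrightarrow> smem z t"
    and "related smem (star card_graph) s a" and "related smem (star card_graph) t b"
  shows "a = b"
proof -
  have "a = b" if prems: "\<forall>z. mem z s \<longleftrightarrow> mem z t" "related mem card_graph s a" "related mem card_graph t b"
    for s t a b
  proof -
    obtain A B where A: "s = mk_set (atom ` A)" "a = atom (card A)"
      "t = mk_set (atom ` B)" "b = atom (card B)"
      using prems(2,3) by auto
    then have "atom ` A = atom ` B"
      using prems(1) by auto
    then have "A = B"
      by (simp add: inj_image_eq_iff inj_atom)
    then show ?thesis
      using A by simp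
  qed
  then have "sat mem (FAll 1 (FAll 2 (FAll 3 (FAll 4 (FImp (FAll 5 (FIff (FMem 5 1) (FMem 5 2)))
      (FImp (FRel 0 1 3) (FImp (FRel 0 2 4) (FEq 3 4))))))))
      ((!) [card_graph])"
    by (simp del: related_card_graph)
  from transfer[OF this] show ?thesis
    using assms by (simp add: star_rel_def) blast
qed

lemma internal_card_eq:
  assumes "related smem (star card_graph) s a"
  shows "internal_card {x. smem x s} = a"
  unfolding internal_card_def
proof (rule the_equality)
  show "\<exists>t. {x. smem x t} = {x. smem x s} \<and> related smem (star card_graph) t a"
    using assms by blast
  show "b = a" if "\<exists>t. {x. smem x t} = {x. smem x s} \<and> related smem (star card_graph) t b" for b
    using that card_graph_unique[OF _ _ assms] by blast
qed

text \<open>A fresh code \<open>t\<close> is provided because \<open>s\<close> could be a memberless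
  urelement, which the graph of cardinality does not relate to anything.\<close>

lemma card_graph_exists:
  assumes "h \<in> hypernats" and "\<And>z. smem z s \<Longrightarrow> z \<in> initial_segment h"
  shows "\<exists>t a. (\<forall>z. smem z t \<longleftrightarrow> smem z s) \<and> related smem (star card_graph) t a \<and> star_rel (\<le>) a h"
proof -
  let ?le = "nat_rel (\<le>)"
  have "\<exists>t a. (\<forall>z. mem z t \<longleftrightarrow> mem z s) \<and> related mem card_graph t a \<and> related mem ?le a h"
    if h: "mem h nat_set"
      and s: "\<forall>z. mem z s \<longrightarrow> mem z nat_set \<and> related mem ?le (atom 1) z \<and> related mem ?le z h" for h s
  proof -
    obtain n where n: "h = atom n"
      using h by auto
    define A where "A = {m. mem (atom m) s}"
    have "A \<subseteq> {1..n}"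
      using s n unfolding A_def by fastforce
    then have "finite A" "card A \<le> n"
      using finite_subset card_mono[of "{1..n}" A] by auto
    moreover have "z \<in> atom ` A \<longleftrightarrow> mem z s" for z
      using s by (auto simp: A_def)
    ultimately show ?thesis
      using n by (intro exI[of _ "mk_set (atom ` A)"] exI[of _ "atom (card A)"]) auto
  qed
  then have "sat mem (FAll 4 (FAll 5 (FImp (FMem 4 0)
      (FImp (FAll 6 (FImp (FMem 6 5) (FConj (FMem 6 0) (FConj (FRel 1 2 6) (FRel 1 6 4)))))
        (FEx 7 (FEx 8 (FConj (FAll 6 (FIff (FMem 6 7) (FMem 6 5))) (FConj (FRel 3 7 8) (FRel 1 8 4)))))))))
      ((!) [nat_set, ?le, atom 1, card_graph])"
    by (simp del: related_card_graph related_nat_rel mem_nat_set)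
  from transfer[OF this] show ?thesis
    using assms by (simp add: initial_segment_def hypernats_def star_rel_def)
qed

text \<open>Real numbers are not extended: each real pair \<open>r\<close>,
  \<open>\<epsilon>\<close> gives its own standard relation on the naturals, and that relation is
  starred, as in \<open>st_quotient\<close>.\<close>

definition near :: "real \<Rightarrow> real \<Rightarrow> nat \<Rightarrow> nat \<Rightarrow> bool" where
  "near r \<epsilon> m n \<longleftrightarrow> \<bar>real m / real n - r\<bar> < \<epsilon>"

text \<open>Counting is additive on disjoint finite sets, and the two errors add up; this is
  additivity before standard parts are taken.\<close>

lemma star_near_add:
  assumes "\<And>z. \<not> (smem z s \<and> smem z t)" and "\<And>z. smem z u \<longleftrightarrow> smem z s \<or> smem z t"
    and "related smem (star card_graph) s a" and "related smem (star card_graph) t b"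
    and "related smem (star card_graph) u c"
    and "star_rel (near p \<epsilon>) a h" and "star_rel (near q \<epsilon>) b h"
  shows "star_rel (near (p + q) (2 * \<epsilon>)) c h"
proof -
  have "related mem (nat_rel (near (p + q) (2 * \<epsilon>))) c h"
    if prems: "\<forall>z. \<not> (mem z s \<and> mem z t)" "\<forall>z. mem z u \<longleftrightarrow> mem z s \<or> mem z t"
      "related mem card_graph s a" "related mem card_graph t b" "related mem card_graph u c"
      "related mem (nat_rel (near p \<epsilon>)) a h" "related mem (nat_rel (near q \<epsilon>)) b h"
    for s t u a b c h
  proof -
    obtain A B C n where A: "finite A" "s = mk_set (atom ` A)" "a = atom (card A)"
      and B: "finite B" "t = mk_set (atom ` B)" "b = atom (card B)"
      and C: "finite C" "u = mk_set (atom ` C)" "c = atom (card C)"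
      and n: "h = atom n" "near p \<epsilon> (card A) n" "near q \<epsilon> (card B) n"
      using prems(3-7) by auto
    have "A \<inter> B = {}"
      using prems(1) A B by auto
    have "atom ` C = atom ` (A \<union> B)"
      using prems(2) A B C by auto
    then have "C = A \<union> B"
      by (simp add: inj_image_eq_iff inj_atom)
    then have "card C = card A + card B"
      using card_Un_disjoint A B \<open>A \<inter> B = {}\<close> by blast
    then have "near (p + q) (2 * \<epsilon>) (card C) n"
      using n(2,3) by (simp add: near_def add_divide_distrib)
    then show ?thesis
      using C n by auto
  qed
  then have "sat mem (FAll 4 (FAll 5 (FAll 6 (FAll 7 (FAll 8 (FAll 9 (FAll 10
      (FImp (FAll 11 (FNeg (FConj (FMem 11 4) (FMem 11 5))))
      (FImp (FAll 11 (FIff (FMem 11 6) (FDisj (FMem 11 4) (FMem 11 5))))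
      (FImp (FRel 0 4 7) (FImp (FRel 0 5 8) (FImp (FRel 0 6 9)
      (FImp (FRel 1 7 10) (FImp (FRel 2 8 10) (FRel 3 9 10)))))))))))))))
      ((!) [card_graph, nat_rel (near p \<epsilon>), nat_rel (near q \<epsilon>), nat_rel (near (p + q) (2 * \<epsilon>))])"
    by (simp del: related_card_graph related_nat_rel)
  from transfer[OF this] show ?thesis
    using assms by (simp add: star_rel_def) blast
qed

abbreviation pow2_le :: "nat \<Rightarrow> nat \<Rightarrow> bool" where
  "pow2_le k n \<equiv> 2 ^ k \<le> n"

abbreviation nth_bit :: "nat \<Rightarrow> nat \<Rightarrow> bool" where
  "nth_bit k x \<equiv> bit x k"

text \<open>Transfers \<open>card_bits_differ\<close> together with the set of disagreement and its
  count, so that this set comes out internal.\<close>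

lemma star_bits_differ:
  assumes "star_rel pow2_le p h" and "star_rel pow2_le q h" and "p \<noteq> q"
  shows "\<exists>u a. (\<forall>z. smem z u \<longleftrightarrow> z \<in> initial_segment h \<and> (star_rel nth_bit p z \<longleftrightarrow> \<not> star_rel nth_bit q z)) \<and>
    related smem (star card_graph) u a \<and> star_rel (\<lambda>m n. 1 / 4 \<le> real m / real n) a h"
proof -
  let ?le = "nat_rel (\<le>)" and ?bit = "nat_rel nth_bit" and ?pow = "nat_rel pow2_le"
    and ?quarter = "nat_rel (\<lambda>m n. 1 / 4 \<le> real m / real n)"
  have "\<exists>u a. (\<forall>z. mem z u \<longleftrightarrow> (mem z nat_set \<and> related mem ?le (atom 1) z \<and> related mem ?le z h) \<and>
      (related mem ?bit p z \<longleftrightarrow> \<not> related mem ?bit q z)) \<and>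
    related mem card_graph u a \<and> related mem ?quarter a h"
    if prems: "related mem ?pow p h" "related mem ?pow q h" "p \<noteq> q" for p q h
  proof -
    obtain i j n where i: "p = atom i" "q = atom j" "h = atom n" "2 ^ i \<le> n" "2 ^ j \<le> n" "i \<noteq> j"
      using prems by auto
    define A where "A = {x \<in> {1..n}. bit x i \<noteq> bit x j}"
    have "n \<le> 4 * card A"
    proof (cases "i < j")
      case False
      then have "n \<le> 4 * card {x \<in> {1..n}. bit x j \<noteq> bit x i}"
        using i by (intro card_bits_differ) auto
      moreover have "A = {x \<in> {1..n}. bit x j \<noteq> bit x i}"
        by (auto simp: A_def)
      ultimately show ?thesis
        by simp
    qed (use i card_bits_differ A_def in auto)
    \<comment> \<open>Division by zero gives 0, so the bound on the quotient depends on
      \<open>n\<close> being positive.\<close>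
    moreover have "0 < n"
      using i(4) by (metis gr0I le_zero_eq power_not_zero zero_neq_numeral)
    ultimately have "1 / 4 \<le> real (card A) / real n"
      by (simp add: field_simps)
    then have "related mem ?quarter (atom (card A)) h"
      using i(3) by auto
    moreover have "finite A"
      by (simp add: A_def)
    then have "related mem card_graph (mk_set (atom ` A)) (atom (card A))"
      by auto
    moreover have "mem z (mk_set (atom ` A)) \<longleftrightarrow>
      (mem z nat_set \<and> related mem ?le (atom 1) z \<and> related mem ?le z h) \<and>
      (related mem ?bit p z \<longleftrightarrow> \<not> related mem ?bit q z)" for z
      using i by (auto simp: A_def)
    ultimately show ?thesis
      by (intro exI[of _ "mk_set (atom ` A)"] exI[of _ "atom (card A)"] conjI allI)
  qed
  then have "sat mem (FAll 7 (FAll 8 (FAll 9 (FImp (FRel 5 7 9) (FImp (FRel 5 8 9) (FImp (FNeg (FEq 7 8))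
      (FEx 10 (FEx 11 (FConj (FAll 12 (FIff (FMem 12 10)
          (FConj (FConj (FMem 12 0) (FConj (FRel 1 2 12) (FRel 1 12 9)))
            (FIff (FRel 4 7 12) (FNeg (FRel 4 8 12))))))
        (FConj (FRel 3 10 11) (FRel 6 11 9)))))))))))
      ((!) [nat_set, ?le, atom 1, card_graph, ?bit, ?pow, ?quarter])"
    by (simp del: related_card_graph related_nat_rel mem_nat_set)
  from transfer[OF this] show ?thesis
    using assms by (simp add: initial_segment_def hypernats_def star_rel_def)
qed

lemma star_bits_determine:
  assumes "x \<in> initial_segment h" and "y \<in> initial_segment h"
    and "\<And>k. star_rel pow2_le k h \<Longrightarrow> star_rel nth_bit k x \<longleftrightarrow> star_rel nth_bit k y"
  shows "x = y"
proof -
  let ?le = "nat_rel (\<le>)" and ?bit = "nat_rel nth_bit" and ?pow = "nat_rel pow2_le"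
  have "x = y" if prems: "related mem ?le x h" "related mem ?le y h"
    "\<forall>k. related mem ?pow k h \<longrightarrow> (related mem ?bit k x \<longleftrightarrow> related mem ?bit k y)" for x y h
  proof -
    obtain i j n where i: "x = atom i" "y = atom j" "h = atom n" "i \<le> n" "j \<le> n"
      using prems(1,2) by auto
    have "i = j"
      using prems(3) i by (intro bits_determine[of i n j]) auto
    then show ?thesis
      using i by simp
  qed
  then have "sat mem (FAll 3 (FAll 4 (FAll 5 (FImp (FRel 0 3 5) (FImp (FRel 0 4 5)
      (FImp (FAll 6 (FImp (FRel 2 6 5) (FIff (FRel 1 6 3) (FRel 1 6 4)))) (FEq 3 4)))))))
      ((!) [?le, ?bit, ?pow])"
    by (simp del: related_nat_rel)
  from transfer[OF this] show ?thesis
    using assms by (simp add: initial_segment_def star_rel_def) blast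
qed

end

section \<open>The Loeb measure\<close>

context elementary_extension
begin

text \<open>Two distinct candidates have disjoint neighbourhoods of half their distance, and a
  quotient cannot lie in both.\<close>

lemma st_quotient_unique:
  assumes "\<And>\<epsilon>. 0 < \<epsilon> \<Longrightarrow> star_rel (near r \<epsilon>) a h"
  shows "st_quotient a h = r"
proof -
  have "(THE r. \<forall>\<epsilon>>0. star_rel (near r \<epsilon>) a h) = r"
  proof (rule the_equality)
    fix r' assume r': "\<forall>\<epsilon>>0. star_rel (near r' \<epsilon>) a h"
    show "r' = r"
    proof (rule ccontr)
      assume "r' \<noteq> r"
      then have "0 < \<bar>r' - r\<bar> / 2"
        by simp
      with assms r' obtain m n where "near r' (\<bar>r' - r\<bar> / 2) m n" "near r (\<bar>r' - r\<bar> / 2) m n"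
        using star_rel_consistent by blast
      then show False
        unfolding near_def by (smt (verit) field_sum_of_halves)
    qed
  qed (use assms in blast)
  then show ?thesis
    by (simp add: st_quotient_def near_def[abs_def])
qed

lemma st_quotient_near:
  assumes "star_rel (\<le>) a h" and "0 < \<epsilon>"
  shows "star_rel (near (st_quotient a h) \<epsilon>) a h"
proof -
  \<comment> \<open>The upper Dedekind cut of the quotient among the standard reals; its infimum is
    the standard part.\<close>
  define Q where "Q = {q. star_rel (\<lambda>m n. real m / real n < q) a h}"
  have "star_rel (\<lambda>m n. real m / real n < 2) a h"
    using assms(1) by (rule star_rel_mono) (simp add: divide_simps)
  then have "Q \<noteq> {}"
    by (auto simp: Q_def)
  have "bdd_below Q"
  proof (rule bdd_belowI)
    fix q assume "q \<in> Q"
    then have "star_rel (\<lambda>m n. real m / real n < q) a h"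
      by (simp add: Q_def)
    then obtain m n where "real m / real n < q"
      using star_rel_consistent[of _ a h] by blast
    then show "0 \<le> q"
      by (meson divide_nonneg_nonneg le_less_trans less_imp_le of_nat_0_le_iff)
  qed
  have near: "star_rel (near (Inf Q) \<epsilon>) a h" if \<epsilon>: "0 < \<epsilon>" for \<epsilon>
  proof -
    obtain q where "q \<in> Q" "q < Inf Q + \<epsilon>"
      using cInf_lessD[OF \<open>Q \<noteq> {}\<close>, of "Inf Q + \<epsilon>"] \<epsilon> by auto
    then have 1: "star_rel (\<lambda>m n. real m / real n < q) a h"
      by (simp add: Q_def)
    \<comment> \<open>Failing to be in the cut gives just a weak lower bound; the half leaves room
      for the strict inequality in \<open>near\<close>.\<close>
    have "Inf Q - \<epsilon> / 2 \<notin> Q"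
      using cInf_lower[OF _ \<open>bdd_below Q\<close>, of "Inf Q - \<epsilon> / 2"] \<epsilon> by auto
    then have 2: "star_rel (\<lambda>m n. \<not> real m / real n < Inf Q - \<epsilon> / 2) a h"
      using star_rel_total[OF star_rel_hypernats[OF assms(1)], of "\<lambda>m n. real m / real n < Inf Q - \<epsilon> / 2"]
      by (simp add: Q_def)
    show ?thesis
    proof (rule star_rel_mono2[OF 1 2])
      fix m n assume "real m / real n < q" "\<not> real m / real n < Inf Q - \<epsilon> / 2"
      then show "near (Inf Q) \<epsilon> m n"
        unfolding near_def using \<open>q < Inf Q + \<epsilon>\<close> \<epsilon> by linarith
    qed
  qed
  then have "st_quotient a h = Inf Q"
    by (rule st_quotient_unique)
  then show ?thesis
    using near assms(2) by simp
qed

text \<open>Take the size of a supposed violation as the tolerance; a standard pair that close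
  contradicts the bound on its quotient.\<close>

lemma st_quotient_bounds:
  assumes "star_rel (\<le>) a h"
  shows "0 \<le> st_quotient a h" and "st_quotient a h \<le> 1"
proof -
  show "0 \<le> st_quotient a h"
  proof (rule ccontr)
    assume "\<not> ?thesis"
    then have "star_rel (near (st_quotient a h) (- st_quotient a h)) a h"
      by (intro st_quotient_near assms) simp
    then obtain m n where "near (st_quotient a h) (- st_quotient a h) m n"
      using star_rel_consistent[of _ a h] by blast
    moreover have "0 \<le> real m / real n"
      by simp
    ultimately show False
      unfolding near_def by linarith
  qed
  show "st_quotient a h \<le> 1"
  proof (rule ccontr)
    assume "\<not> ?thesis"
    then have "star_rel (near (st_quotient a h) (st_quotient a h - 1)) a h"
      by (intro st_quotient_near assms) simp
    then obtain m n where "near (st_quotient a h) (st_quotient a h - 1) m n" "m \<le> n"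
      using star_rel_consistent[OF _ assms] by blast
    moreover have "real m / real n \<le> 1"
      using \<open>m \<le> n\<close> by (simp add: divide_simps)
    ultimately show False
      unfolding near_def by linarith
  qed
qed

lemma st_quotient_ge:
  assumes "star_rel (\<le>) a h" and "star_rel (\<lambda>m n. c \<le> real m / real n) a h"
  shows "c \<le> st_quotient a h"
proof (rule ccontr)
  assume "\<not> ?thesis"
  then have "star_rel (near (st_quotient a h) (c - st_quotient a h)) a h"
    by (intro st_quotient_near assms) simp
  then obtain m n where "near (st_quotient a h) (c - st_quotient a h) m n" "c \<le> real m / real n"
    using star_rel_consistent[OF _ assms(2)] by blast
  then show False
    unfolding near_def by linarith
qed

section \<open>The algebra of internal subsets and its finitely additive content\<close>

definition internal_subsets :: "'w \<Rightarrow> 'w set set" where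
  "internal_subsets H = {A \<in> internal_sets. A \<subseteq> initial_segment H}"

definition loeb_content :: "'w \<Rightarrow> 'w set \<Rightarrow> real" where
  "loeb_content H A = st_quotient (internal_card A) H"

text \<open>A code whose members are all hypernaturals has rank at most 1, so it survives the
  truncation to finite rank.\<close>

lemma internal_subsets_iff:
  "A \<in> internal_subsets H \<longleftrightarrow> A \<subseteq> initial_segment H \<and> (\<exists>s. A = {x. smem x s})"
proof
  assume A: "A \<subseteq> initial_segment H \<and> (\<exists>s. A = {x. smem x s})"
  then obtain s where s: "A = {x. smem x s}"
    by blast
  have "A \<subseteq> hypernats"
    using A by (auto simp: initial_segment_def)
  then have "s \<in> rank_level hypernats smem 1"
    using s by simp
  then show "A \<in> internal_subsets H"
    using A s unfolding internal_subsets_def internal_sets_def star_universe_def by blast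
qed (auto simp: internal_subsets_def internal_sets_def)

lemma initial_segment_internal:
  assumes "H \<in> hypernats"
  shows "initial_segment H \<in> internal_subsets H"
proof -
  obtain u where "\<And>z. smem z u \<longleftrightarrow> z \<in> initial_segment H"
    using extent_initial_segment[OF assms] by blast
  then show ?thesis
    unfolding internal_subsets_iff by (intro conjI exI[of _ u]) auto
qed

lemma Diff_internal:
  assumes "A \<in> internal_subsets H" and "B \<in> internal_subsets H"
  shows "A - B \<in> internal_subsets H"
proof -
  obtain s t where s: "A = {x. smem x s}" "B = {x. smem x t}"
    using assms by (auto simp: internal_subsets_iff)
  obtain u where "\<And>z. smem z u \<longleftrightarrow> smem z s \<and> \<not> smem z t"
    using extent_Diff by blast
  then show ?thesis
    using assms(1) s unfolding internal_subsets_iff by (intro conjI exI[of _ u]) auto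
qed

lemma algebra_internal_subsets:
  assumes "H \<in> hypernats"
  shows "algebra (initial_segment H) (internal_subsets H)"
proof -
  have "A \<inter> B \<in> internal_subsets H" if "A \<in> internal_subsets H" "B \<in> internal_subsets H" for A B
    using Diff_internal[OF that(1) Diff_internal[OF that]] by (simp add: Diff_Diff_Int)
  moreover have "{} \<in> internal_subsets H"
    using Diff_internal[OF initial_segment_internal[OF assms] initial_segment_internal[OF assms]]
    by simp
  moreover have "internal_subsets H \<subseteq> Pow (initial_segment H)"
    by (auto simp: internal_subsets_def)
  ultimately show ?thesis
    unfolding algebra_iff_Int
    using Diff_internal[OF initial_segment_internal[OF assms]] by blast
qed

lemma internal_card_graph:
  assumes "H \<in> hypernats" and "A \<in> internal_subsets H"
  obtains s where "A = {x. smem x s}" and "related smem (star card_graph) s (internal_card A)"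
    and "star_rel (\<le>) (internal_card A) H"
proof -
  obtain s where s: "A = {x. smem x s}" "\<And>z. smem z s \<Longrightarrow> z \<in> initial_segment H"
    using assms(2) by (auto simp: internal_subsets_iff)
  obtain t a where t: "\<And>z. smem z t \<longleftrightarrow> smem z s" "related smem (star card_graph) t a"
    "star_rel (\<le>) a H"
    using card_graph_exists[OF assms(1) s(2)] by blast
  have "A = {x. smem x t}"
    using s(1) t(1) by simp
  moreover have "internal_card {x. smem x t} = a"
    using t(2) by (rule internal_card_eq)
  ultimately show ?thesis
    using that[of t] t(2,3) by simp
qed

lemma loeb_content_add:
  assumes "H \<in> hypernats" and "A \<in> internal_subsets H" and "B \<in> internal_subsets H"
    and "A \<inter> B = {}"
  shows "loeb_content H (A \<union> B) = loeb_content H A + loeb_content H B"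
proof -
  interpret algebra "initial_segment H" "internal_subsets H"
    using assms(1) by (rule algebra_internal_subsets)
  obtain s where s: "A = {x. smem x s}" "related smem (star card_graph) s (internal_card A)"
    "star_rel (\<le>) (internal_card A) H"
    by (rule internal_card_graph[OF assms(1,2)])
  obtain t where t: "B = {x. smem x t}" "related smem (star card_graph) t (internal_card B)"
    "star_rel (\<le>) (internal_card B) H"
    by (rule internal_card_graph[OF assms(1,3)])
  have "A \<union> B \<in> internal_subsets H"
    using assms(2,3) by (rule Un)
  then obtain u where u: "A \<union> B = {x. smem x u}"
    "related smem (star card_graph) u (internal_card (A \<union> B))"
    by (rule internal_card_graph[OF assms(1)])
  show ?thesis
    unfolding loeb_content_def
  proof (rule st_quotient_unique)
    fix \<epsilon> :: real assume "0 < \<epsilon>"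
    then have half: "0 < \<epsilon> / 2"
      by simp
    have disj: "\<not> (smem z s \<and> smem z t)" for z
      using assms(4) s(1) t(1) by auto
    have un: "smem z u \<longleftrightarrow> smem z s \<or> smem z t" for z
      using u(1) s(1) t(1) by auto
    show "star_rel (near (st_quotient (internal_card A) H + st_quotient (internal_card B) H) \<epsilon>)
        (internal_card (A \<union> B)) H"
      using star_near_add[OF disj un s(2) t(2) u(2) st_quotient_near[OF s(3) half]
          st_quotient_near[OF t(3) half]] by simp
  qed
qed

lemma loeb_content_bounds:
  assumes "H \<in> hypernats" and "A \<in> internal_subsets H"
  shows "0 \<le> loeb_content H A" and "loeb_content H A \<le> 1"
proof -
  have "star_rel (\<le>) (internal_card A) H"
    using internal_card_graph[OF assms] by blast
  from st_quotient_bounds[OF this] show "0 \<le> loeb_content H A" "loeb_content H A \<le> 1"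
    by (simp_all add: loeb_content_def)
qed

lemma loeb_content_empty:
  assumes "H \<in> hypernats"
  shows "loeb_content H {} = 0"
proof -
  have "{} \<in> internal_subsets H"
    using algebra_internal_subsets[OF assms] by (simp add: algebra_iff_Int)
  from loeb_content_add[OF assms this this] show ?thesis
    by simp
qed

lemma loeb_content_UN:
  fixes A :: "nat \<Rightarrow> _"
  assumes H: "H \<in> hypernats" and A: "\<And>i. A i \<in> internal_subsets H" and "disjoint_family A"
  shows "(\<Union>i<n. A i) \<in> internal_subsets H \<and> loeb_content H (\<Union>i<n. A i) = (\<Sum>i<n. loeb_content H (A i))"
proof (induction n)
  case 0
  then show ?case
    using algebra_internal_subsets[OF H] loeb_content_empty[OF H] by (simp add: algebra_iff_Int)
next
  case (Suc n)
  interpret algebra "initial_segment H" "internal_subsets H"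
    using H by (rule algebra_internal_subsets)
  have eq: "(\<Union>i<Suc n. A i) = (\<Union>i<n. A i) \<union> A n"
    by (auto simp: lessThan_Suc)
  have "A i \<inter> A n = {}" if "i < n" for i
    using assms(3) that by (auto simp: disjoint_family_on_def)
  then have "(\<Union>i<n. A i) \<inter> A n = {}"
    by blast
  then show ?case
    using Suc A Un loeb_content_add[OF H, of "\<Union>i<n. A i" "A n"] unfolding eq by simp
qed

end

section \<open>Countable additivity from saturation, and the Loeb measure\<close>

context nonstandard_universe
begin

text \<open>The remainders \<open>R n\<close> are internal and decreasing. With infinitely many
  nonempty pieces none of them is empty, and saturation gives a common point, yet every point of the
  union lies in some piece.\<close>

lemma disjoint_internal_cover_finite:
  fixes A :: "nat \<Rightarrow> _"
  assumes H: "H \<in> hypernats" and A: "\<And>i. A i \<in> internal_subsets H"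
    and disj: "disjoint_family A" and U: "(\<Union>i. A i) \<in> internal_subsets H"
  shows "\<exists>n. \<forall>i\<ge>n. A i = {}"
proof (rule ccontr)
  assume "\<not> ?thesis"
  then have ne: "\<exists>i\<ge>n. A i \<noteq> {}" for n
    by blast
  define R where "R n = (\<Union>i. A i) - (\<Union>i<n. A i)" for n
  have "R n \<in> internal_subsets H" for n
    unfolding R_def using Diff_internal[OF U] loeb_content_UN[OF H A disj] by blast
  then have sub: "range R \<subseteq> internal_sets"
    by (auto simp: internal_subsets_def)
  have R_mono: "R n \<subseteq> R m" if "m \<le> n" for m n
    using that by (fastforce simp: R_def)
  have R_ne: "R n \<noteq> {}" for n
  proof -
    obtain i x where i: "n \<le> i" "x \<in> A i"
      using ne by blast
    have "A k \<inter> A i = {}" if "k < n" for k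
      using disj by (rule disjoint_family_onD) (use that i(1) in auto)
    then show ?thesis
      using i by (auto simp: R_def)
  qed
  have "fip (range R)"
    unfolding fip_def
  proof (intro allI impI)
    fix \<F> assume "\<F> \<subseteq> range R" "finite \<F>"
    then obtain I where I: "finite I" "\<F> = R ` I"
      by (meson finite_subset_image)
    \<comment> \<open>The remainder of largest index is contained in all the others; inserting 0
      provides a maximum for the empty subfamily.\<close>
    have "R (Max (insert 0 I)) \<subseteq> \<Inter>\<F>"
      unfolding I(2) using I(1) by (intro INT_greatest R_mono Max_ge) auto
    then show "\<Inter>\<F> \<noteq> {}"
      using R_ne by blast
  qed
  then have "\<Inter>(range R) \<noteq> {}"
    using omega1_saturated sub by blast
  then show False
    by (auto simp: R_def)
qed

text \<open>Countable additivity on the algebra reduces to finite additivity, since a disjoint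
  internal cover of an internal set has finitely many nonempty members; Caratheodory's theorem then
  extends the content.\<close>

lemma
  assumes H: "H \<in> hypernats"
  shows emeasure_loeb_measure:
      "A \<in> internal_subsets H \<Longrightarrow> emeasure (loeb_measure H) A = ennreal (loeb_content H A)"
    and sets_loeb_measure: "A \<in> internal_subsets H \<Longrightarrow> A \<in> sets (loeb_measure H)"
    and space_loeb_measure: "space (loeb_measure H) = initial_segment H"
proof -
  interpret algebra "initial_segment H" "internal_subsets H"
    using H by (rule algebra_internal_subsets)
  define L where "L = extend_measure (initial_segment H) (internal_subsets H) (\<lambda>A. A)
    (\<lambda>A. ennreal (loeb_content H A))"
  have loeb: "loeb_measure H = completion L"
    by (simp add: loeb_measure_def L_def internal_subsets_def loeb_content_def)
  have L_sets: "A \<in> sets L" if "A \<in> internal_subsets H" for A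
    unfolding L_def using that space_closed by (subst sets_extend_measure) auto
  have L_emeasure: "emeasure L A = ennreal (loeb_content H A)" if "A \<in> internal_subsets H" for A
  proof (rule extend_measure_caratheodory[OF L_def that])
    show "semiring_of_sets (initial_segment H) ((\<lambda>A. A) ` internal_subsets H)"
      by (simp add: semiring_of_sets_axioms)
    fix B :: "nat \<Rightarrow> 'b set" and j
    assume B: "B \<in> UNIV \<rightarrow> internal_subsets H" "j \<in> internal_subsets H"
      "disjoint_family ((\<lambda>A. A) \<circ> B)" "(\<Union>i. B i) = j"
    then have B': "\<And>i. B i \<in> internal_subsets H" "disjoint_family B" "(\<Union>i. B i) \<in> internal_subsets H"
      by (auto simp: comp_def)
    obtain n where n: "\<And>i. n \<le> i \<Longrightarrow> B i = {}"
      using disjoint_internal_cover_finite[OF H B'] by blast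
    have "i < n" if "x \<in> B i" for x i
      using n[of i] that by (cases "n \<le> i") auto
    then have "(\<Union>i. B i) = (\<Union>i<n. B i)"
      by auto
    then have "loeb_content H j = (\<Sum>i<n. loeb_content H (B i))"
      using loeb_content_UN[OF H B'(1,2)] B(4) by simp
    moreover have "(\<Sum>i. ennreal (loeb_content H (B i))) = (\<Sum>i<n. ennreal (loeb_content H (B i)))"
      using n loeb_content_empty[OF H] by (intro suminf_finite) (auto simp: not_less)
    ultimately show "(\<Sum>i. ennreal (loeb_content H (B i))) = ennreal (loeb_content H j)"
      using loeb_content_bounds(1)[OF H B'(1)] by (simp add: sum_ennreal)
  qed (simp_all add: loeb_content_empty[OF H])
  show "emeasure (loeb_measure H) A = ennreal (loeb_content H A)" if "A \<in> internal_subsets H"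
    using L_sets[OF that] L_emeasure[OF that] by (simp add: loeb)
  show "A \<in> sets (loeb_measure H)" if "A \<in> internal_subsets H"
    using L_sets[OF that] by (simp add: loeb)
  show "space (loeb_measure H) = initial_segment H"
    using space_closed by (simp add: loeb L_def space_extend_measure)
qed

lemma finite_loeb_measure:
  assumes "H \<in> hypernats"
  shows "finite_measure (loeb_measure H)"
  by (rule finite_measureI)
    (simp add: space_loeb_measure assms emeasure_loeb_measure initial_segment_internal)

lemma loeb_measure_bits_differ:
  assumes H: "H \<in> hypernats" and "star_rel pow2_le p H" and "star_rel pow2_le q H" and "p \<noteq> q"
  shows "\<exists>E\<in>sets (loeb_measure H). 0 < measure (loeb_measure H) E \<and>
    (\<forall>x\<in>E. star_rel nth_bit p x \<longleftrightarrow> \<not> star_rel nth_bit q x)"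
proof -
  obtain u a where u: "\<And>z. smem z u \<longleftrightarrow> z \<in> initial_segment H \<and>
      (star_rel nth_bit p z \<longleftrightarrow> \<not> star_rel nth_bit q z)"
    and a: "related smem (star card_graph) u a" "star_rel (\<lambda>m n. 1 / 4 \<le> real m / real n) a H"
    using star_bits_differ[OF assms(2-4)] by blast
  define E where "E = {x. smem x u}"
  have E: "E \<in> internal_subsets H"
    using u by (auto simp: internal_subsets_iff E_def)
  have "internal_card E = a"
    unfolding E_def using a(1) by (rule internal_card_eq)
  moreover have "star_rel (\<le>) (internal_card E) H"
    using internal_card_graph[OF H E] by blast
  ultimately have "1 / 4 \<le> loeb_content H E"
    unfolding loeb_content_def using a(2) by (intro st_quotient_ge) simp_all
  moreover have "measure (loeb_measure H) E = loeb_content H E"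
    using emeasure_loeb_measure[OF H E] loeb_content_bounds(1)[OF H E]
    by (simp add: measure_def)
  ultimately have "0 < measure (loeb_measure H) E"
    by linarith
  then show ?thesis
    using sets_loeb_measure[OF H E] u by (auto simp: E_def)
qed

end

theorem theorem10:
  fixes lam :: "'l rel" and kap :: "'k rel"
    and atom :: "nat \<Rightarrow> 'v" and mem :: "'v \<Rightarrow> 'v \<Rightarrow> bool"
    and smem :: "'w \<Rightarrow> 'w \<Rightarrow> bool" and star :: "'v \<Rightarrow> 'w"
    and H :: 'w
  assumes "strong_limit_cardinal lam"
    and "is_cofinality kap lam"
    and "\<And>\<mu> :: 'k rel. Card_order \<mu> \<Longrightarrow> \<mu> <o kap \<Longrightarrow> \<mu> ^c natLeq <o kap"
    and "nonstandard_universe atom mem smem star"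
    and "H \<in> elementary_extension.hypernats atom mem smem star
             - elementary_extension.standard_nats atom star"
    and "|elementary_extension.initial_segment atom mem smem star H| =o lam"
  shows "\<not> compact_measure_space (elementary_extension.loeb_measure atom mem smem star H)"
proof -
  interpret nonstandard_universe atom mem smem star
    by (rule assms(4))
  have H: "H \<in> hypernats"
    using assms(5) by blast
  show ?thesis
  \<comment> \<open>The index set is an internal logarithm of \<open>H\<close>, and
    \<open>B k\<close> consists of the points whose digit \<open>k\<close> is 1.\<close>
  proof (rule not_compact_of_separating_family[OF assms(1-3) finite_loeb_measure[OF H],
        where I = "{k. star_rel pow2_le k H}" and B = "\<lambda>k. {x. star_rel nth_bit k x}"])
    show "|space (loeb_measure H)| =o lam"
      using assms(6) by (simp add: space_loeb_measure[OF H])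
  next
    fix x y
    assume "x \<in> space (loeb_measure H)" "y \<in> space (loeb_measure H)"
      "\<And>k. k \<in> {k. star_rel pow2_le k H} \<Longrightarrow>
        x \<in> {x. star_rel nth_bit k x} \<longleftrightarrow> y \<in> {x. star_rel nth_bit k x}"
    then show "x = y"
      by (intro star_bits_determine[of x H y]) (simp_all add: space_loeb_measure[OF H])
  next
    fix p q
    assume "p \<in> {k. star_rel pow2_le k H}" "q \<in> {k. star_rel pow2_le k H}" "p \<noteq> q"
    then show "\<exists>E\<in>sets (loeb_measure H). 0 < measure (loeb_measure H) E \<and>
        (\<forall>x\<in>E. x \<in> {x. star_rel nth_bit p x} \<longleftrightarrow> x \<notin> {x. star_rel nth_bit q x})"
      using loeb_measure_bits_differ[OF H] by simp
  qed
qed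

end
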